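(* Let $n\ge 3$ and let $B$ be the open unit ball of $\mathbb{R}^n$ centered at the origin. For every $\lambda\in(0,n-1)$ there exist a finite time $T\in(0,\infty)$ and a time-independent divergence-free drift $u\in L^{n-\lambda}(B;\mathbb{R}^n)$ such that the parabolic equation $$\partial_t v-\Delta v+(u\cdot\nabla)v=0\quad\text{in } B\times[0,T]$$ has a bounded weak solution $v$ which is not continuous at the origin at time $T$, i.e. not continuous at the point $(x,t)=(0,T)$.
   Context: Divergence-free is understood in the sense of distributions. A weak solution of $\partial_t v-\Delta v+(u\cdot\nabla)v=0$ in $B\times[0,T]$ is a scalar function $v\in L^\infty_tL^2_x\cap L^2_tH^1_x$ on $B\times[0,T]$ solving the equation in the sense of distributions; no initial or boundary conditions are prescribed. Since $v$ is defined up to null sets, "not continuous at $(0,T)$" means that no function on $B\times[0,T]$ agreeing almost everywhere with $v$ is continuous at $(0,T)$. *)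

theory Defs
  imports "HOL-Analysis.Analysis"
begin

section \<open>Test functions\<close>

definition partial :: "'a::euclidean_space \<Rightarrow> ('a \<Rightarrow> real) \<Rightarrow> 'a \<Rightarrow> real" where
  "partial b f x = frechet_derivative f (at x) b"

primrec C_k :: "nat \<Rightarrow> ('a::euclidean_space \<Rightarrow> real) \<Rightarrow> bool" where
  "C_k 0 f \<longleftrightarrow> continuous_on UNIV f"
| "C_k (Suc k) f \<longleftrightarrow> f differentiable_on UNIV \<and> (\<forall>b\<in>Basis. C_k k (partial b f))"

definition test_function :: "'a::euclidean_space set \<Rightarrow> ('a \<Rightarrow> real) \<Rightarrow> bool" where
  "test_function S \<phi> \<longleftrightarrow>
     (\<forall>k. C_k k \<phi>) \<and> compact (closure {x. \<phi> x \<noteq> 0}) \<and> closure {x. \<phi> x \<noteq> 0} \<subseteq> S"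

definition grad :: "('a::euclidean_space \<Rightarrow> real) \<Rightarrow> 'a \<Rightarrow> 'a" where
  "grad f x = (\<Sum>b\<in>Basis. partial b f x *\<^sub>R b)"

definition laplacian :: "('a::euclidean_space \<Rightarrow> real) \<Rightarrow> 'a \<Rightarrow> real" where
  "laplacian f x = (\<Sum>b\<in>Basis. partial b (partial b f) x)"


section \<open>Function spaces\<close>

text \<open>The Bochner integral of a non-integrable function is 0 by convention, so integrability
  is always required explicitly wherever an integral is used below.\<close>

definition in_Lp ::
  "real \<Rightarrow> 'a::euclidean_space set \<Rightarrow> ('a \<Rightarrow> 'b::euclidean_space) \<Rightarrow> bool" where
  "in_Lp p S f \<longleftrightarrow>
     set_borel_measurable lebesgue S f \<and>
     set_integrable lebesgue S (\<lambda>x. norm (f x) powr p)"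

definition locally_integrable ::
  "'a::euclidean_space set \<Rightarrow> ('a \<Rightarrow> 'b::euclidean_space) \<Rightarrow> bool" where
  "locally_integrable S f \<longleftrightarrow> (\<forall>K. compact K \<and> K \<subseteq> S \<longrightarrow> set_integrable lebesgue K f)"

definition divergence_free :: "'a::euclidean_space set \<Rightarrow> ('a \<Rightarrow> 'a) \<Rightarrow> bool" where
  "divergence_free S u \<longleftrightarrow>
     locally_integrable S u \<and>
     (\<forall>\<phi>. test_function S \<phi> \<longrightarrow> (LINT x:S|lebesgue. u x \<bullet> grad \<phi> x) = 0)"

definition weak_gradient ::
  "'a::euclidean_space set \<Rightarrow> ('a \<Rightarrow> real) \<Rightarrow> ('a \<Rightarrow> 'a) \<Rightarrow> bool" where
  "weak_gradient S f g \<longleftrightarrow>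
     locally_integrable S f \<and> locally_integrable S g \<and>
     (\<forall>\<phi>. test_function S \<phi> \<longrightarrow>
        (\<forall>b\<in>Basis. (LINT x:S|lebesgue. f x * partial b \<phi> x)
                    = - (LINT x:S|lebesgue. (g x \<bullet> b) * \<phi> x)))"

definition Linf_t_L2_x :: "'a::euclidean_space set \<Rightarrow> real \<Rightarrow> ('a \<times> real \<Rightarrow> real) \<Rightarrow> bool" where
  "Linf_t_L2_x S T v \<longleftrightarrow>
     set_borel_measurable lebesgue (S \<times> {0..T}) v \<and>
     (\<exists>C. AE t in lebesgue. t \<in> {0..T} \<longrightarrow>
        in_Lp 2 S (\<lambda>x. v (x, t)) \<and> (LINT x:S|lebesgue. (v (x, t))\<^sup>2) \<le> C)"

definition L2_t_H1_x :: "'a::euclidean_space set \<Rightarrow> real \<Rightarrow> ('a \<times> real \<Rightarrow> real) \<Rightarrow> bool" where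
  "L2_t_H1_x S T v \<longleftrightarrow>
     set_borel_measurable lebesgue (S \<times> {0..T}) v \<and>
     (\<exists>g. set_borel_measurable lebesgue (S \<times> {0..T}) g \<and>
        (AE t in lebesgue. t \<in> {0..T} \<longrightarrow>
           in_Lp 2 S (\<lambda>x. v (x, t)) \<and> in_Lp 2 S (\<lambda>x. g (x, t)) \<and>
           weak_gradient S (\<lambda>x. v (x, t)) (\<lambda>x. g (x, t))) \<and>
        set_integrable lebesgue {0..T}
          (\<lambda>t. LINT x:S|lebesgue. (v (x, t))\<^sup>2 + (norm (g (x, t)))\<^sup>2))"


section \<open>Weak solutions\<close>

text \<open>Since \<open>u\<close> is divergence-free, the distribution \<open>(u \<cdot> \<nabla>)v\<close> is \<open>div (v u)\<close>; as usual it
  is defined whenever \<open>v u\<close> is locally integrable, without requiring \<open>u \<cdot> \<nabla>v\<close> to be a locally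
  integrable function. Test functions are supported in the interior, so neither initial nor
  boundary conditions are imposed.\<close>

definition weak_solution ::
  "'a::euclidean_space set \<Rightarrow> real \<Rightarrow> ('a \<Rightarrow> 'a) \<Rightarrow> ('a \<times> real \<Rightarrow> real) \<Rightarrow> bool" where
  "weak_solution S T u v \<longleftrightarrow>
     Linf_t_L2_x S T v \<and> L2_t_H1_x S T v \<and>
     locally_integrable (S \<times> {0<..<T}) v \<and>
     locally_integrable (S \<times> {0<..<T}) (\<lambda>(x, t). v (x, t) *\<^sub>R u x) \<and>
     (\<forall>\<phi>. test_function (S \<times> {0<..<T}) \<phi> \<longrightarrow>
        (LINT (x, t):S \<times> {0<..<T}|lebesgue.
           v (x, t) * (deriv (\<lambda>s. \<phi> (x, s)) t + laplacian (\<lambda>y. \<phi> (y, t)) x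
                       + u x \<bullet> grad (\<lambda>y. \<phi> (y, t)) x)) = 0)"

definition essentially_bounded :: "'a::euclidean_space set \<Rightarrow> ('a \<Rightarrow> real) \<Rightarrow> bool" where
  "essentially_bounded S f \<longleftrightarrow> (\<exists>C. AE z in lebesgue. z \<in> S \<longrightarrow> \<bar>f z\<bar> \<le> C)"

definition ae_continuous_at :: "'a::euclidean_space set \<Rightarrow> 'a \<Rightarrow> ('a \<Rightarrow> real) \<Rightarrow> bool" where
  "ae_continuous_at S z f \<longleftrightarrow>
     (\<exists>w. (AE y in lebesgue. y \<in> S \<longrightarrow> w y = f y) \<and> continuous (at z within S) w)"

end

(* The example is stationary and explicit. Write x = y + z e with y orthogonal to the axis e, R = |x|^2,
   i = 2 - j for a small j > 0, rho = |z|^(-j), and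
     B = R + A z^2 (rho - 1),   V = z B^(-1/i).
   On the axis V tends to A^(-1/i) as z decreases to 0 and to -A^(-1/i) as z increases to 0; the change
   of sign across the plane z = 0 takes place in a layer |z| ~ |y|^(2/i), thin compared with |y|.
   An axisymmetric divergence-free field u with Stokes stream function |y|^(n-1) kappa satisfies
   u . grad V = Laplace V iff kappa satisfies a first-order equation along the level curves of V.
   For z > 0, V is a function of |y|^2 z^(-i) - L z^j, where L = A - 1; for the right value of L that
   equation has the closed-form solution kappa below, with |u| <= C |z|^(-j) / |x|. This lies in L^p for
   any given p < n once j is small, and grad V is square integrable because n >= 3.
   In divergence form the equation says that V u - grad V is the field with stream function |y|^(n-1) h
   for an explicit h. Hence both the divergence-freeness of u and the weak equation, across the
   singularity, reduce to integration by parts and the symmetry of the second derivatives of the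
   test function. *)
theory Submission
  imports Defs
begin

section \<open>Test functions\<close>

text \<open>The term L z^j cannot be dropped. With L = 0, V would be constant along each half of the
  axis, so its gradient would vanish there, while for z > 0 its Laplacian would be strictly
  negative, V having a strict maximum across the axis; no finite drift balances that. For L > 0, V
  increases along the axis away from the origin, and near the origin an inflow along the axis
  supplies the missing term. Since L = M y0 / j, the construction has no direct analogue at j = 0,
  and u only comes close to the scale-invariant size 1 / |x|.

  The obstacle is regularity. V is C1 away from the origin, but \<kappa> contains z |z|^(-j), which
  is continuous and not differentiable across the plane z = 0. Gradients are therefore classical
  only off that plane, and all integrations by parts must tolerate it together with the origin. They
  do so line by line, without cutting out a neighbourhood of the singular set; the price is local
  integrability of the gradients of V, \<kappa> and h, and the worst of these, of size |z|^(-j)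
  |x|^(-2-j), dictates how small j must be.\<close>

lemma partial_eqI:
  assumes "(f has_derivative D) (at x)"
  shows "partial b f x = D b"
  using frechet_derivative_at[OF assms] by (simp add: partial_def)

lemma partial_GDERIV:
  assumes "GDERIV f x :> d"
  shows "partial b f x = b \<bullet> d"
  using assms by (simp add: gderiv_def partial_eqI)

lemma GDERIV_imp_isCont:
  assumes "GDERIV f x :> d"
  shows "isCont f x"
  using assms unfolding gderiv_def by (rule has_derivative_continuous)

text \<open>Connects the coordinatewise \<open>grad\<close> with \<open>GDERIV\<close>, whose
  product, quotient and composition rules carry all later differentiations.\<close>

lemma GDERIV_grad:
  assumes "f differentiable (at x)"
  shows "GDERIV f x :> grad f x"
proof -
  have D: "(f has_derivative frechet_derivative f (at x)) (at x)"
    using assms frechet_derivative_works by blast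
  have "frechet_derivative f (at x) h = h \<bullet> grad f x" for h
  proof -
    have "frechet_derivative f (at x) h = frechet_derivative f (at x) (\<Sum>b\<in>Basis. (h \<bullet> b) *\<^sub>R b)"
      by (simp add: euclidean_representation)
    also have "\<dots> = (\<Sum>b\<in>Basis. (h \<bullet> b) * frechet_derivative f (at x) b)"
      using has_derivative_linear[OF D] by (simp add: linear_sum linear_scale)
    finally show ?thesis
      by (simp add: grad_def partial_def inner_sum_right mult.commute)
  qed
  then have "frechet_derivative f (at x) = (\<lambda>h. h \<bullet> grad f x)" by auto
  with D show ?thesis by (simp add: gderiv_def)
qed

lemma grad_inner_Basis:
  assumes "b \<in> Basis"
  shows "grad f x \<bullet> b = partial b f x"
  using assms by (simp add: grad_def inner_sum_left inner_Basis if_distrib sum.delta cong: if_cong)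

lemma GDERIV_has_real_derivative_line:
  fixes f :: "'a::real_inner \<Rightarrow> real"
  assumes "GDERIV f (x + t *\<^sub>R b) :> d"
  shows "((\<lambda>t. f (x + t *\<^sub>R b)) has_real_derivative b \<bullet> d) (at t)"
proof -
  have "((\<lambda>t. x + t *\<^sub>R b) has_derivative (\<lambda>h. h *\<^sub>R b)) (at t)"
    by (auto intro!: derivative_eq_intros)
  from has_derivative_compose[OF this, of f "\<lambda>h. h \<bullet> d"] assms
  have "((\<lambda>t. f (x + t *\<^sub>R b)) has_derivative (\<lambda>s. s * (b \<bullet> d))) (at t)"
    by (simp add: gderiv_def)
  moreover have "(\<lambda>s. s * (b \<bullet> d)) = (*) (b \<bullet> d)"
    by auto
  ultimately show ?thesis
    by (simp add: has_field_derivative_def)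
qed

section \<open>Symmetry of second derivatives\<close>

lemma C_k_Suc_differentiable: "C_k (Suc k) f \<Longrightarrow> f differentiable (at x)"
  by (auto simp: differentiable_on_def)

text \<open>The mean value theorem is applied twice: along \<open>b\<close> to the increment of
  \<open>f\<close> in direction \<open>c\<close>, then along \<open>c\<close> to
  \<open>partial b f\<close>. Exact intermediate points avoid any uniformity argument.\<close>

lemma second_difference_partial:
  fixes f :: "'a::euclidean_space \<Rightarrow> real"
  assumes C2: "C_k 2 f" and b: "b \<in> Basis" and c: "c \<in> Basis" and h: "0 < h"
  obtains s t where "0 < s" "s < h" "0 < t" "t < h"
    "f (x + h *\<^sub>R b + h *\<^sub>R c) - f (x + h *\<^sub>R b) - f (x + h *\<^sub>R c) + f x
      = h * h * partial c (partial b f) (x + s *\<^sub>R b + t *\<^sub>R c)"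
proof -
  have df: "f differentiable (at y)" and dbf: "partial b f differentiable (at y)" for y
    using C2 b by (auto simp: numeral_2_eq_2 differentiable_on_def)
  have D: "((\<lambda>s. f (y + s *\<^sub>R b)) has_real_derivative partial b f (y + s *\<^sub>R b)) (at s)" for y s
    using GDERIV_has_real_derivative_line[OF GDERIV_grad[OF df], where x = y and t = s and b = b] grad_inner_Basis[OF b]
    by (simp add: inner_commute)
  have D2: "((\<lambda>t. partial b f (y + t *\<^sub>R c)) has_real_derivative partial c (partial b f) (y + t *\<^sub>R c)) (at t)" for y t
    using GDERIV_has_real_derivative_line[OF GDERIV_grad[OF dbf], where x = y and t = t and b = c] grad_inner_Basis[OF c]
    by (simp add: inner_commute)
  define g where "g s = f ((x + h *\<^sub>R c) + s *\<^sub>R b) - f (x + s *\<^sub>R b)" for s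
  have "\<exists>z>0. z < h \<and> g h - g 0 = (h - 0) * (partial b f ((x + h *\<^sub>R c) + z *\<^sub>R b) - partial b f (x + z *\<^sub>R b))"
    unfolding g_def by (rule MVT2[OF h]) (intro DERIV_diff D)
  then obtain s where s: "0 < s" "s < h"
    "g h - g 0 = h * (partial b f ((x + h *\<^sub>R c) + s *\<^sub>R b) - partial b f (x + s *\<^sub>R b))"
    by auto
  have "\<exists>z>0. z < h \<and> partial b f (x + s *\<^sub>R b + h *\<^sub>R c) - partial b f (x + s *\<^sub>R b + 0 *\<^sub>R c)
      = (h - 0) * partial c (partial b f) (x + s *\<^sub>R b + z *\<^sub>R c)"
    by (rule MVT2[OF h]) (rule D2)
  then obtain t where t: "0 < t" "t < h"
    "partial b f (x + s *\<^sub>R b + h *\<^sub>R c) - partial b f (x + s *\<^sub>R b)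
      = h * partial c (partial b f) (x + s *\<^sub>R b + t *\<^sub>R c)"
    by auto
  have "g h - g 0 = h * h * partial c (partial b f) (x + s *\<^sub>R b + t *\<^sub>R c)"
    using s(3) t(3) by (simp add: add_ac)
  then show thesis
    using s t that[of s t] by (simp add: g_def add_ac)
qed

text \<open>The second difference is symmetric in \<open>b\<close> and \<open>c\<close>, so both
  mixed derivatives take a common value at points arbitrarily close to \<open>x\<close>; continuity
  does the rest.\<close>

lemma partial_commute:
  fixes f :: "'a::euclidean_space \<Rightarrow> real"
  assumes C2: "C_k 2 f" and b: "b \<in> Basis" and c: "c \<in> Basis"
  shows "partial b (partial c f) x = partial c (partial b f) x"
proof (rule ccontr)
  let ?P = "partial b (partial c f)" and ?Q = "partial c (partial b f)"
  assume ne: "?P x \<noteq> ?Q x"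
  define e where "e = \<bar>?P x - ?Q x\<bar> / 2"
  have e: "0 < e" using ne by (simp add: e_def)
  have "isCont ?P x" "isCont ?Q x"
    using C2 b c by (auto simp: numeral_2_eq_2 continuous_on_eq_continuous_at)
  then obtain d1 d2 where d: "0 < d1" "0 < d2"
    "\<And>y. dist y x < d1 \<Longrightarrow> dist (?P y) (?P x) < e" "\<And>y. dist y x < d2 \<Longrightarrow> dist (?Q y) (?Q x) < e"
    using e unfolding continuous_at_eps_delta by blast
  \<comment> \<open>The intermediate points lie within 2 \<open>h\<close> of \<open>x\<close>, hence
    inside both continuity radii.\<close>
  define h where "h = min d1 d2 / 3"
  have h: "0 < h" using d by (simp add: h_def)
  have near: "dist (x + s *\<^sub>R b' + t *\<^sub>R c') x < min d1 d2"
    if "0 < s" "s < h" "0 < t" "t < h" "b' \<in> Basis" "c' \<in> Basis" for s t b' c'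
  proof -
    have "dist (x + s *\<^sub>R b' + t *\<^sub>R c') x = norm (s *\<^sub>R b' + t *\<^sub>R c')"
      by (simp add: dist_norm)
    also have "\<dots> \<le> s + t"
      using that by (intro norm_triangle_le) auto
    finally show ?thesis using that h by (simp add: h_def)
  qed
  obtain s t where 1: "0 < s" "s < h" "0 < t" "t < h"
    "f (x + h *\<^sub>R b + h *\<^sub>R c) - f (x + h *\<^sub>R b) - f (x + h *\<^sub>R c) + f x
      = h * h * ?Q (x + s *\<^sub>R b + t *\<^sub>R c)"
    by (rule second_difference_partial[OF C2 b c h])
  obtain s' t' where 2: "0 < s'" "s' < h" "0 < t'" "t' < h"
    "f (x + h *\<^sub>R c + h *\<^sub>R b) - f (x + h *\<^sub>R c) - f (x + h *\<^sub>R b) + f x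
      = h * h * ?P (x + s' *\<^sub>R c + t' *\<^sub>R b)"
    by (rule second_difference_partial[OF C2 c b h])
  have "f (x + h *\<^sub>R b + h *\<^sub>R c) = f (x + h *\<^sub>R c + h *\<^sub>R b)"
    by (rule arg_cong[where f = f]) (simp add: add_ac)
  then have "h * h * ?Q (x + s *\<^sub>R b + t *\<^sub>R c) = h * h * ?P (x + s' *\<^sub>R c + t' *\<^sub>R b)"
    using 1(5) 2(5) by linarith
  then have eq: "?Q (x + s *\<^sub>R b + t *\<^sub>R c) = ?P (x + s' *\<^sub>R c + t' *\<^sub>R b)"
    using h by simp
  have "dist (?Q (x + s *\<^sub>R b + t *\<^sub>R c)) (?Q x) < e" "dist (?P (x + s' *\<^sub>R c + t' *\<^sub>R b)) (?P x) < e"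
    using d near[OF 1(1-4) b c] near[OF 2(1-4) c b] by auto
  with eq show False unfolding e_def dist_real_def by (smt (verit) field_sum_of_halves)
qed

section \<open>C1 functions vanishing off a given set\<close>

lemma partial_eq_0_outside:
  assumes "closed K" "\<And>y. y \<notin> K \<Longrightarrow> f y = 0" "x \<notin> K"
  shows "GDERIV f x :> 0" "partial b f x = 0"
proof -
  have "((\<lambda>y. 0) has_derivative (\<lambda>h. h \<bullet> 0)) (at x)" by simp
  then have "(f has_derivative (\<lambda>h. h \<bullet> 0)) (at x)"
    by (rule has_derivative_transform_within_open[where s = "- K"]) (use assms in auto)
  then show "GDERIV f x :> 0" unfolding gderiv_def .
  then show "partial b f x = 0" by (simp add: partial_GDERIV)
qed

text \<open>Integration by parts is applied not only to a test function but to its first derivatives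
  and to their products with coordinates. This class contains all of these and is easily seen to be
  closed under sums and such products.\<close>

definition C1_support :: "'a::euclidean_space set \<Rightarrow> ('a \<Rightarrow> real) \<Rightarrow> bool" where
  "C1_support K f \<longleftrightarrow> (\<forall>x. f differentiable (at x)) \<and> (\<forall>b\<in>Basis. continuous_on UNIV (partial b f)) \<and>
     (\<forall>x. x \<notin> K \<longrightarrow> f x = 0)"

lemma C1_supportI:
  assumes "C_k (Suc 0) f" "\<And>x. x \<notin> K \<Longrightarrow> f x = 0"
  shows "C1_support K f"
  using assms C_k_Suc_differentiable[OF assms(1)] by (simp add: C1_support_def)

lemma C1_support_partial:
  assumes "C_k 2 f" "closed K" "\<And>x. x \<notin> K \<Longrightarrow> f x = 0" "b \<in> Basis"
  shows "C1_support K (partial b f)"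
proof (rule C1_supportI)
  show "C_k (Suc 0) (partial b f)"
    using assms(1,4) unfolding numeral_2_eq_2 by (subst (asm) C_k.simps(2)) blast
  show "partial b f x = 0" if "x \<notin> K" for x
    by (rule partial_eq_0_outside(2)[OF assms(2) _ that]) (rule assms(3))
qed

lemma test_function_support:
  assumes "test_function S f"
  obtains K where "compact K" "K \<subseteq> S" "C1_support K f" "\<And>b. b \<in> Basis \<Longrightarrow> C1_support K (partial b f)"
    "C_k 2 f"
proof
  let ?K = "closure {x. f x \<noteq> 0}"
  show "compact ?K" "?K \<subseteq> S" using assms by (auto simp: test_function_def)
  have C: "C_k k f" for k using assms unfolding test_function_def by blast
  then show "C_k 2 f" .
  have 0: "f x = 0" if "x \<notin> ?K" for x
    using that closure_subset[of "{x. f x \<noteq> 0}"] by auto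
  show "C1_support ?K f"
    by (rule C1_supportI[OF C 0])
  show "C1_support ?K (partial b f)" if "b \<in> Basis" for b
    by (rule C1_support_partial[OF C closed_closure 0 that])
qed

section \<open>Integration by parts for functions singular at a point\<close>

lemma AE_lborel_inner_Basis_ne:
  assumes "b \<in> Basis"
  shows "AE x in lborel. x \<bullet> b \<noteq> (c::real)"
proof -
  have "{x. x \<bullet> b = c} \<in> null_sets lebesgue"
    using negligible_standard_hyperplane[OF assms] by (simp add: negligible_iff_null_sets)
  moreover have "{x. x \<bullet> b = c} \<in> sets borel" by measurable
  ultimately have "{x. x \<bullet> b = c} \<in> null_sets lborel"
    by (simp add: null_sets_completion_iff)
  then show ?thesis
    by (rule AE_I') auto
qed

lemma
  fixes f :: "'a::euclidean_space \<Rightarrow> real"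
  assumes "integrable lborel f"
  shows integrable_lborel_translate: "integrable lborel (\<lambda>x. f (x + c))"
    and integral_lborel_translate: "(\<integral>x. f (x + c) \<partial>lborel) = (\<integral>x. f x \<partial>lborel)"
proof -
  have m [measurable]: "f \<in> borel_measurable borel"
    using assms by (simp add: integrable_iff_bounded)
  have D: "distr lborel borel ((+) c) = (lborel :: 'a measure)"
    by (rule lborel_distr_plus)
  have "integrable (distr lborel borel ((+) c)) f"
    using assms by (simp only: D)
  then show "integrable lborel (\<lambda>x. f (x + c))"
    by (subst (asm) integrable_distr_eq) (simp_all add: add.commute)
  have "(\<integral>x. f x \<partial>lborel) = (\<integral>x. f x \<partial>(distr lborel borel ((+) c)))"
    by (simp only: D)
  also have "\<dots> = (\<integral>x. f (x + c) \<partial>lborel)"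
    by (subst integral_distr) (simp_all add: add.commute)
  finally show "(\<integral>x. f (x + c) \<partial>lborel) = (\<integral>x. f x \<partial>lborel)" ..
qed

text \<open>The integral of \<open>G (x + b) - G x\<close> vanishes by translation invariance; writing the
  difference as \<open>\<integral>g (x + t b) dt\<close> and using Fubini, it also equals the integral of \<open>g\<close>.\<close>

lemma integral_directional_derivative_eq_0:
  fixes G g :: "'a::euclidean_space \<Rightarrow> real"
  assumes G: "integrable lborel G" and g: "integrable lborel g"
    and ftc: "AE x in lborel. continuous_on {0..1} (\<lambda>t. G (x + t *\<^sub>R b)) \<and>
       (\<exists>S. finite S \<and> (\<forall>t\<in>{0<..<1} - S.
          ((\<lambda>t. G (x + t *\<^sub>R b)) has_real_derivative g (x + t *\<^sub>R b)) (at t)))"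
  shows "(\<integral>x. g x \<partial>lborel) = 0"
proof -
  have [measurable]: "g \<in> borel_measurable borel" "G \<in> borel_measurable borel"
    using G g by (simp_all add: integrable_iff_bounded)
  \<comment> \<open>Fubini needs a jointly integrable function, hence the cut-off to the unit time
    interval in \<open>t\<close>; every slice in \<open>x\<close> has the same L1 norm as
    \<open>g\<close>.\<close>
  define F where "F t x = indicator {0..1} t * g (x + t *\<^sub>R b)" for t :: real and x
  have Fm [measurable]: "case_prod F \<in> borel_measurable (lborel \<Otimes>\<^sub>M lborel)"
    unfolding F_def by measurable
  have gt: "integrable lborel (\<lambda>x. g (x + t *\<^sub>R b))" for t
    by (rule integrable_lborel_translate[OF g])
  have int: "integrable (lborel \<Otimes>\<^sub>M lborel) (case_prod F)"
  proof (rule lborel_pair.Fubini_integrable[OF Fm])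
    have "(\<integral>x. norm (case_prod F (t, x)) \<partial>lborel) = indicator {0..1} t * (\<integral>x. \<bar>g x\<bar> \<partial>lborel)" for t
      using integral_lborel_translate[OF integrable_abs[OF g], of "t *\<^sub>R b"]
      by (simp add: F_def abs_mult)
    then show "integrable lborel (\<lambda>t. \<integral>x. norm (case_prod F (t, x)) \<partial>lborel)"
      by simp
    show "AE t in lborel. integrable lborel (\<lambda>x. case_prod F (t, x))"
      unfolding F_def using gt by simp
  qed
  have "(\<integral>x. g x \<partial>lborel) = (\<integral>t. (\<integral>x. F t x \<partial>lborel) \<partial>lborel)"
    using integral_lborel_translate[OF g] by (simp add: F_def)
  also have "\<dots> = (\<integral>x. (\<integral>t. F t x \<partial>lborel) \<partial>lborel)"
    using lborel_pair.Fubini_integral[OF int] by simp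
  also have "\<dots> = (\<integral>x. G (x + b) - G x \<partial>lborel)"
  proof (rule integral_cong_AE)
    have "AE x in lborel. integrable lborel (\<lambda>t. F t x)"
      using lborel_pair.AE_integrable_snd[OF int] .
    with ftc show "AE x in lborel. (\<integral>t. F t x \<partial>lborel) = G (x + b) - G x"
    proof eventually_elim
      case (elim x)
      then obtain S where S: "finite S" "\<And>t. t \<in> {0<..<1} - S \<Longrightarrow>
          ((\<lambda>t. G (x + t *\<^sub>R b)) has_vector_derivative g (x + t *\<^sub>R b)) (at t)"
        by (auto simp: has_real_derivative_iff_has_vector_derivative)
      have "((\<lambda>t. g (x + t *\<^sub>R b)) has_integral G (x + 1 *\<^sub>R b) - G (x + 0 *\<^sub>R b)) {0..1}"
        by (rule fundamental_theorem_of_calculus_interior_strong[OF S(1)]) (use S(2) elim(1) in auto)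
      then have "((\<lambda>t. if t \<in> {0..1} then g (x + t *\<^sub>R b) else 0) has_integral G (x + b) - G x) UNIV"
        by (simp only: has_integral_restrict_UNIV scaleR_one scaleR_zero_left add_0_right)
      then have "((\<lambda>t. F t x) has_integral G (x + b) - G x) UNIV"
        by (rule has_integral_eq[rotated]) (simp add: F_def)
      moreover have "((\<lambda>t. F t x) has_integral (\<integral>t. F t x \<partial>lborel)) UNIV"
        using has_integral_integral_lborel[OF elim(2)] .
      ultimately show ?case
        by (rule has_integral_unique[symmetric])
    qed
  qed measurable
  also have "\<dots> = 0"
    using integral_lborel_translate[OF G] integrable_lborel_translate[OF G] G by simp
  finally show ?thesis .
qed

lemma continuous_support_bounded:
  fixes f :: "'a::euclidean_space \<Rightarrow> real"
  assumes "continuous_on UNIV f" "compact K" "\<And>x. x \<notin> K \<Longrightarrow> f x = 0"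
  obtains C where "0 \<le> C" "\<And>x. \<bar>f x\<bar> \<le> C"
proof -
  have "compact (f ` K)"
    using assms continuous_on_subset compact_continuous_image by blast
  then obtain C where C: "\<forall>x\<in>K. \<bar>f x\<bar> \<le> C"
    by (auto dest!: compact_imp_bounded simp: bounded_iff)
  show thesis
  proof (rule that[of "max C 0"])
    show "\<bar>f x\<bar> \<le> max C 0" for x
      using C assms(3)[of x] by (cases "x \<in> K") auto
  qed simp
qed

lemma integrable_mult_support:
  fixes f h :: "'a::euclidean_space \<Rightarrow> real"
  assumes f: "continuous_on UNIV f" "\<And>x. x \<notin> K \<Longrightarrow> f x = 0" and K: "compact K"
    and h: "set_integrable lborel K h"
  shows "integrable lborel (\<lambda>x. h x * f x)"
proof -
  obtain C where C: "0 \<le> C" "\<And>x. \<bar>f x\<bar> \<le> C"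
    using continuous_support_bounded[OF f(1) K f(2)] by blast
  have [measurable]: "f \<in> borel_measurable borel"
    using f(1) by (rule borel_measurable_continuous_onI)
  have h': "integrable lborel (\<lambda>x. indicator K x * h x)"
    using h by (simp add: set_integrable_def)
  have [measurable]: "(\<lambda>x. indicator K x * h x) \<in> borel_measurable lborel"
    using h' by (rule borel_measurable_integrable)
  have "integrable lborel (\<lambda>x. (indicator K x * h x) * f x)"
  proof (rule Bochner_Integration.integrable_bound)
    show "integrable lborel (\<lambda>x. C * (indicator K x * h x))" using h' by simp
    show "AE x in lborel. norm (indicator K x * h x * f x) \<le> norm (C * (indicator K x * h x))"
      using C by (intro AE_I2) (auto simp: abs_mult mult.commute intro!: mult_right_mono)
  qed measurable
  also have "(\<lambda>x. (indicator K x * h x) * f x) = (\<lambda>x. h x * f x)"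
    using f(2) by (force simp: indicator_def fun_eq_iff)
  finally show ?thesis .
qed

lemma C1_support_continuous_on: "C1_support K f \<Longrightarrow> continuous_on UNIV f"
  by (auto simp: C1_support_def continuous_on_eq_continuous_at intro: differentiable_imp_continuous_within)

text \<open>Almost every line parallel to a basis vector avoids the origin and either meets the hyperplane
  \<open>x \<bullet> e = 0\<close> in a single point or not at all, so a classical gradient off that
  hyperplane and continuity off the origin suffice.\<close>

lemma
  fixes h :: "'a::euclidean_space \<Rightarrow> real" and H :: "'a \<Rightarrow> 'a"
  assumes e: "e \<in> Basis" and b: "b \<in> Basis" and dim: "2 \<le> DIM('a)"
    and K: "compact K" "K \<subseteq> U" "open U" and \<phi>: "C1_support K \<phi>"
    and h: "set_integrable lborel K h" and H: "set_integrable lborel K H"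
    and cont: "\<And>x. x \<in> U \<Longrightarrow> x \<noteq> 0 \<Longrightarrow> isCont h x"
    and der: "\<And>x. x \<in> U \<Longrightarrow> x \<bullet> e \<noteq> 0 \<Longrightarrow> GDERIV h x :> H x"
  shows integrable_mult_partial: "integrable lborel (\<lambda>x. h x * partial b \<phi> x)"
    and integrable_grad_mult: "integrable lborel (\<lambda>x. (H x \<bullet> b) * \<phi> x)"
    and integral_by_parts_partial:
      "(\<integral>x. h x * partial b \<phi> x \<partial>lborel) = - (\<integral>x. (H x \<bullet> b) * \<phi> x \<partial>lborel)"
proof -
  have \<phi>0: "\<phi> x = 0" if "x \<notin> K" for x using \<phi> that by (simp add: C1_support_def)
  have cK: "closed K" using K compact_imp_closed by blast
  have p0: "partial b \<phi> x = 0" if "x \<notin> K" for x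
    by (rule partial_eq_0_outside(2)[OF cK \<phi>0 that])
  have dif: "\<phi> differentiable (at x)" for x using \<phi> by (simp add: C1_support_def)
  have c\<phi>: "continuous_on UNIV \<phi>" by (rule C1_support_continuous_on[OF \<phi>])
  have Hb: "set_integrable lborel K (\<lambda>x. H x \<bullet> b)"
    using integrable_inner_left[OF H[unfolded set_integrable_def], of b] by (simp add: set_integrable_def)
  show i1: "integrable lborel (\<lambda>x. h x * partial b \<phi> x)"
    using \<phi> b by (intro integrable_mult_support[OF _ p0 K(1) h]) (auto simp: C1_support_def)
  show i2: "integrable lborel (\<lambda>x. (H x \<bullet> b) * \<phi> x)"
    by (rule integrable_mult_support[OF c\<phi> \<phi>0 K(1) Hb])
  let ?G = "\<lambda>x. h x * \<phi> x"
  have iG: "integrable lborel ?G"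
    by (rule integrable_mult_support[OF c\<phi> \<phi>0 K(1) h])
  have out: "GDERIV ?G y :> 0" if "y \<notin> K" for y
    by (rule partial_eq_0_outside(1)[OF cK _ that]) (simp add: \<phi>0)
  have D: "GDERIV ?G y :> h y *\<^sub>R grad \<phi> y + \<phi> y *\<^sub>R H y" if "y \<bullet> e \<noteq> 0" for y
  proof (cases "y \<in> K")
    case True
    then show ?thesis using K that by (intro GDERIV_mult GDERIV_grad dif der) auto
  next
    case False
    have "grad \<phi> y = 0"
      using partial_eq_0_outside(2)[OF cK \<phi>0 False] by (simp add: grad_def)
    then show ?thesis using out[OF False] \<phi>0[OF False] by simp
  qed
  have C: "isCont ?G y" if "y \<noteq> 0" for y
  proof (cases "y \<in> K")
    case True
    then show ?thesis using K that c\<phi> by (intro continuous_intros cont) (auto simp: continuous_on_eq_continuous_at)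
  next
    case False
    then show ?thesis using out GDERIV_imp_isCont by blast
  qed
  \<comment> \<open>A line in direction \<open>b\<close> changes only the \<open>b\<close>
    coordinate. At least one of \<open>e\<close> and \<open>b'\<close> differs from
    \<open>b\<close>, so a starting point with both coordinates nonzero gives a line that misses the
    origin.\<close>
  have "\<exists>b'\<in>Basis. b' \<noteq> e"
  proof (rule ccontr)
    assume "\<not> ?thesis"
    then have "Basis = {e}" using e by blast
    then have "DIM('a) = card {e}" by (simp only:)
    then show False using dim by simp
  qed
  then obtain b' where b': "b' \<in> Basis" "b' \<noteq> e" by blast
  have "(\<integral>x. h x * partial b \<phi> x + (H x \<bullet> b) * \<phi> x \<partial>lborel) = 0"
  proof (rule integral_directional_derivative_eq_0[OF iG, where b = b])
    show "integrable lborel (\<lambda>x. h x * partial b \<phi> x + (H x \<bullet> b) * \<phi> x)"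
      using i1 i2 by simp
    have "AE x in lborel. x \<bullet> e \<noteq> 0" "AE x in lborel. x \<bullet> b' \<noteq> 0"
      using AE_lborel_inner_Basis_ne e b' by blast+
    then show "AE x in lborel. continuous_on {0..1} (\<lambda>t. ?G (x + t *\<^sub>R b)) \<and>
       (\<exists>S. finite S \<and> (\<forall>t\<in>{0<..<1} - S. ((\<lambda>t. ?G (x + t *\<^sub>R b)) has_real_derivative
          h (x + t *\<^sub>R b) * partial b \<phi> (x + t *\<^sub>R b) + (H (x + t *\<^sub>R b) \<bullet> b) * \<phi> (x + t *\<^sub>R b)) (at t)))"
    proof eventually_elim
      case (elim x)
      have ne: "x + t *\<^sub>R b \<noteq> 0" for t
      proof
        assume "x + t *\<^sub>R b = 0"
        then have "(x + t *\<^sub>R b) \<bullet> e = 0" "(x + t *\<^sub>R b) \<bullet> b' = 0" by simp_all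
        then show False
          using elim b b' e by (cases "b = e") (auto simp: inner_add_left inner_Basis)
      qed
      have "isCont (\<lambda>t. ?G (x + t *\<^sub>R b)) t" for t
        by (rule isCont_o2[where g = ?G]) (intro continuous_intros C ne)+
      moreover have "((\<lambda>t. ?G (x + t *\<^sub>R b)) has_real_derivative
          h (x + t *\<^sub>R b) * partial b \<phi> (x + t *\<^sub>R b) + (H (x + t *\<^sub>R b) \<bullet> b) * \<phi> (x + t *\<^sub>R b)) (at t)"
        if "t \<in> {0<..<1} - {- (x \<bullet> e)}" for t
      proof -
        \<comment> \<open>For \<open>b = e\<close> the line meets the plane only at the excluded
          parameter; for any other \<open>b\<close> the \<open>e\<close> coordinate stays equal to
          that of \<open>x\<close>.\<close>
        have "(x + t *\<^sub>R b) \<bullet> e \<noteq> 0"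
          using elim b e that by (auto simp: inner_add_left inner_Basis)
        from GDERIV_has_real_derivative_line[OF D[OF this]] show ?thesis
          using grad_inner_Basis[OF b] by (simp add: inner_add_right inner_commute mult.commute)
      qed
      ultimately show ?case
        by (intro conjI exI[of _ "{- (x \<bullet> e)}"]) (auto intro: continuous_at_imp_continuous_on)
    qed
  qed
  then show "(\<integral>x. h x * partial b \<phi> x \<partial>lborel) = - (\<integral>x. (H x \<bullet> b) * \<phi> x \<partial>lborel)"
    using i1 i2 by simp
qed

section \<open>Stream fields and their weak divergence\<close>

text \<open>For \<open>y \<bottom> e\<close> and \<open>x = y + z e\<close>, the field with Stokes stream function \<open>|y|\<^sup>n\<^sup>-\<^sup>1 f\<close> is the
  divergence of the antisymmetric matrix \<open>f (e \<otimes> x - x \<otimes> e)\<close>, which is the following expression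
  in \<open>f\<close> and its gradient \<open>F\<close>.\<close>

definition stream_field :: "'a::euclidean_space \<Rightarrow> ('a \<Rightarrow> real) \<Rightarrow> ('a \<Rightarrow> 'a) \<Rightarrow> 'a \<Rightarrow> 'a" where
  "stream_field e f F x = ((real DIM('a) - 1) * f x + x \<bullet> F x) *\<^sub>R e - (e \<bullet> F x) *\<^sub>R x"

lemma partial_inner_mult:
  assumes "f differentiable (at x)"
  shows "partial c (\<lambda>x. (x \<bullet> b) * f x) x = (c \<bullet> b) * f x + (x \<bullet> b) * partial c f x"
proof -
  have D: "GDERIV f x :> grad f x" by (rule GDERIV_grad[OF assms])
  have "GDERIV (\<lambda>x. x \<bullet> b) x :> b"
    unfolding gderiv_def by (auto intro!: derivative_eq_intros)
  from partial_GDERIV[OF GDERIV_mult[OF this D], of c] partial_GDERIV[OF D, of c]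
  show ?thesis by (simp add: inner_add_right mult.commute)
qed

lemma C1_support_inner_mult:
  assumes "C1_support K f"
  shows "C1_support K (\<lambda>x. (x \<bullet> b) * f x)"
proof -
  have f: "f differentiable (at x)" "c \<in> Basis \<Longrightarrow> continuous_on UNIV (partial c f)" "x \<notin> K \<Longrightarrow> f x = 0" for x c
    using assms by (auto simp: C1_support_def)
  have "partial c (\<lambda>x. (x \<bullet> b) * f x) = (\<lambda>x. (c \<bullet> b) * f x + (x \<bullet> b) * partial c f x)" for c
    using f(1) by (intro ext partial_inner_mult)
  then show ?thesis
    using f C1_support_continuous_on[OF assms] unfolding C1_support_def
    by (auto intro!: continuous_intros differentiable_mult differentiable_inner)
qed

lemma partial_sum:
  assumes "finite I" "\<And>k. k \<in> I \<Longrightarrow> f k differentiable (at x)"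
  shows "partial c (\<lambda>x. \<Sum>k\<in>I. f k x) x = (\<Sum>k\<in>I. partial c (f k) x)"
proof -
  have "((\<lambda>x. \<Sum>k\<in>I. f k x) has_derivative (\<lambda>h. \<Sum>k\<in>I. frechet_derivative (f k) (at x) h)) (at x)"
    using assms by (intro has_derivative_sum) (auto simp: frechet_derivative_works)
  from partial_eqI[OF this] show ?thesis by (simp add: partial_def)
qed

lemma C1_support_sum:
  assumes "finite I" "\<And>k. k \<in> I \<Longrightarrow> C1_support K (f k)"
  shows "C1_support K (\<lambda>x. \<Sum>k\<in>I. f k x)"
proof -
  have f: "k \<in> I \<Longrightarrow> f k differentiable (at x)" "k \<in> I \<Longrightarrow> c \<in> Basis \<Longrightarrow> continuous_on UNIV (partial c (f k))"
    "k \<in> I \<Longrightarrow> x \<notin> K \<Longrightarrow> f k x = 0" for x c k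
    using assms(2) by (auto simp: C1_support_def)
  have "partial c (\<lambda>x. \<Sum>k\<in>I. f k x) = (\<lambda>x. \<Sum>k\<in>I. partial c (f k) x)" for c
    using f(1) assms(1) by (intro ext partial_sum)
  then show ?thesis
    using f assms(1) unfolding C1_support_def
    by (auto intro!: continuous_intros differentiable_sum)
qed

text \<open>One derivative is moved from \<open>H\<close> onto first derivatives of
  \<open>\<phi>\<close>, so that only the gradient of \<open>h\<close> is ever used. For the stream
  field this contracts an antisymmetric matrix with the Hessian of \<open>\<phi>\<close>, which
  gives 0.\<close>

lemma
  fixes h :: "'a::euclidean_space \<Rightarrow> real" and H :: "'a \<Rightarrow> 'a"
  assumes e: "e \<in> Basis" and dim: "2 \<le> DIM('a)"
    and K: "compact K" "K \<subseteq> U" "open U"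
    and \<phi>: "C_k 2 \<phi>" "\<And>x. x \<notin> K \<Longrightarrow> \<phi> x = 0"
    and h: "set_integrable lborel K h" and H: "set_integrable lborel K H"
    and cont: "\<And>x. x \<in> U \<Longrightarrow> x \<noteq> 0 \<Longrightarrow> isCont h x"
    and der: "\<And>x. x \<in> U \<Longrightarrow> x \<bullet> e \<noteq> 0 \<Longrightarrow> GDERIV h x :> H x"
  shows integrable_stream_field: "integrable lborel (\<lambda>x. stream_field e h H x \<bullet> grad \<phi> x)"
    and integral_stream_field: "(\<integral>x. stream_field e h H x \<bullet> grad \<phi> x \<partial>lborel) = 0"
    and integrable_laplacian: "integrable lborel (\<lambda>x. h x * laplacian \<phi> x)"
    and integrable_grad_grad: "integrable lborel (\<lambda>x. H x \<bullet> grad \<phi> x)"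
    and integral_laplacian: "(\<integral>x. h x * laplacian \<phi> x \<partial>lborel) = - (\<integral>x. H x \<bullet> grad \<phi> x \<partial>lborel)"
proof -
  have cK: "closed K" using K compact_imp_closed by blast
  have S: "C1_support K (partial b \<phi>)" if "b \<in> Basis" for b
    using C1_support_partial[OF \<phi>(1) cK \<phi>(2) that] by blast
  have d2: "partial b \<phi> differentiable (at x)" if "b \<in> Basis" for b x
    using S[OF that] by (simp add: C1_support_def)
  note ibp = integrable_mult_partial[OF e _ dim K _ h H cont der]
    integrable_grad_mult[OF e _ dim K _ h H cont der] integral_by_parts_partial[OF e _ dim K _ h H cont der]
  let ?p = "\<lambda>b. partial b \<phi>"
  have HG: "H x \<bullet> grad \<phi> x = (\<Sum>b\<in>Basis. (H x \<bullet> b) * ?p b x)" for x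
    by (simp add: grad_def inner_sum_right mult.commute)
  show "integrable lborel (\<lambda>x. h x * laplacian \<phi> x)" "integrable lborel (\<lambda>x. H x \<bullet> grad \<phi> x)"
    unfolding HG laplacian_def sum_distrib_left
    by (auto intro!: Bochner_Integration.integrable_sum ibp(1,2) S)
  have "(\<integral>x. h x * laplacian \<phi> x \<partial>lborel) = (\<Sum>b\<in>Basis. \<integral>x. h x * partial b (?p b) x \<partial>lborel)"
    unfolding laplacian_def sum_distrib_left by (intro Bochner_Integration.integral_sum ibp(1) S)
  also have "\<dots> = (\<Sum>b\<in>Basis. - (\<integral>x. (H x \<bullet> b) * ?p b x \<partial>lborel))"
    by (intro sum.cong ibp(3) S refl)
  also have "\<dots> = - (\<integral>x. H x \<bullet> grad \<phi> x \<partial>lborel)"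
    unfolding HG by (subst Bochner_Integration.integral_sum) (auto intro!: ibp(2) S simp: sum_negf)
  finally show "(\<integral>x. h x * laplacian \<phi> x \<partial>lborel) = - (\<integral>x. H x \<bullet> grad \<phi> x \<partial>lborel)" .
  let ?f = "\<lambda>b x. (x \<bullet> b) * ?p e x" and ?g = "\<lambda>x. \<Sum>b\<in>Basis. (x \<bullet> b) * ?p b x"
  have f: "C1_support K (?f b)" for b by (intro C1_support_inner_mult S e)
  have g: "C1_support K ?g" by (intro C1_support_sum C1_support_inner_mult S finite_Basis)
  have pf: "partial b (?f b) x = ?p e x + (x \<bullet> b) * partial b (?p e) x" if "b \<in> Basis" for b x
    using that by (simp add: partial_inner_mult d2 e)
  have pg: "partial e ?g x = ?p e x + (\<Sum>b\<in>Basis. (x \<bullet> b) * partial e (?p b) x)" for x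
  proof -
    have "partial e ?g x = (\<Sum>b\<in>Basis. partial e (\<lambda>x. (x \<bullet> b) * ?p b x) x)"
      by (rule partial_sum) (auto intro!: differentiable_mult differentiable_inner d2)
    also have "\<dots> = (\<Sum>b\<in>Basis. (e \<bullet> b) * ?p b x) + (\<Sum>b\<in>Basis. (x \<bullet> b) * partial e (?p b) x)"
      unfolding sum.distrib[symmetric] by (intro sum.cong refl partial_inner_mult d2)
    also have "(\<Sum>b\<in>Basis. (e \<bullet> b) * ?p b x) = ?p e x"
      using e by (simp add: inner_Basis if_distrib[of "\<lambda>t. t * _"] cong: if_cong)
    finally show ?thesis .
  qed
  have xg: "x \<bullet> grad \<phi> x = ?g x" for x
    by (simp add: grad_def inner_sum_right mult.commute)
  have eg: "e \<bullet> grad \<phi> x = ?p e x" for x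
    using grad_inner_Basis[OF e] by (simp add: inner_commute)
  have xH: "x \<bullet> H x = (\<Sum>b\<in>Basis. (H x \<bullet> b) * (x \<bullet> b))" for x
    by (subst euclidean_inner) (simp add: mult.commute)
  \<comment> \<open>The product rule yields n copies of the \<open>e\<close> derivative from the
    \<open>?f b\<close> and one from \<open>?g\<close>, which the factor n - 1 balances; the
    second-order terms cancel by symmetry.\<close>
  have lap0: "(real DIM('a) - 1) * ?p e x - (\<Sum>b\<in>Basis. partial b (?f b) x) + partial e ?g x = 0" for x
    using partial_commute[OF \<phi>(1)] e unfolding pg by (simp add: pf sum.distrib left_diff_distrib)
  have expand: "stream_field e h H x \<bullet> grad \<phi> x
      = (real DIM('a) - 1) * (h x * ?p e x) + (\<Sum>b\<in>Basis. (H x \<bullet> b) * ?f b x) - (H x \<bullet> e) * ?g x" for x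
    unfolding stream_field_def inner_diff_left inner_scaleR_left eg xg xH
    by (simp add: distrib_left distrib_right sum_distrib_left sum_distrib_right mult_ac inner_commute)
  have hp: "integrable lborel (\<lambda>x. h x * ?p e x)"
    by (rule integrable_mult_support[OF C1_support_continuous_on[OF S[OF e]] _ K(1) h])
      (use S[OF e] in \<open>auto simp: C1_support_def\<close>)
  have i1: "integrable lborel (\<lambda>x. \<Sum>b\<in>Basis. (H x \<bullet> b) * ?f b x)"
    by (intro Bochner_Integration.integrable_sum ibp(2) f)
  have i2: "integrable lborel (\<lambda>x. (H x \<bullet> e) * ?g x)"
    by (intro ibp(2) g e)
  have i3: "integrable lborel (\<lambda>x. \<Sum>b\<in>Basis. h x * partial b (?f b) x)"
    by (intro Bochner_Integration.integrable_sum ibp(1) f)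
  have i4: "integrable lborel (\<lambda>x. h x * partial e ?g x)"
    by (intro ibp(1) g e)
  show "integrable lborel (\<lambda>x. stream_field e h H x \<bullet> grad \<phi> x)"
    unfolding expand using hp i1 i2 by simp
  have "(\<integral>x. stream_field e h H x \<bullet> grad \<phi> x \<partial>lborel)
      = (real DIM('a) - 1) * (\<integral>x. h x * ?p e x \<partial>lborel)
        + (\<integral>x. (\<Sum>b\<in>Basis. (H x \<bullet> b) * ?f b x) \<partial>lborel) - (\<integral>x. (H x \<bullet> e) * ?g x \<partial>lborel)"
    unfolding expand using hp i1 i2 by simp
  also have "(\<integral>x. (\<Sum>b\<in>Basis. (H x \<bullet> b) * ?f b x) \<partial>lborel) = (\<Sum>b\<in>Basis. \<integral>x. (H x \<bullet> b) * ?f b x \<partial>lborel)"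
    by (intro Bochner_Integration.integral_sum ibp(2) f)
  also have "\<dots> = - (\<Sum>b\<in>Basis. \<integral>x. h x * partial b (?f b) x \<partial>lborel)"
    unfolding sum_negf[symmetric] using ibp(3)[OF _ f] by (intro sum.cong) auto
  also have "(\<Sum>b\<in>Basis. \<integral>x. h x * partial b (?f b) x \<partial>lborel) = (\<integral>x. (\<Sum>b\<in>Basis. h x * partial b (?f b) x) \<partial>lborel)"
    by (intro Bochner_Integration.integral_sum[symmetric] ibp(1) f)
  also have "(\<integral>x. (H x \<bullet> e) * ?g x \<partial>lborel) = - (\<integral>x. h x * partial e ?g x \<partial>lborel)"
    using ibp(3)[OF e g] by simp
  also have "(real DIM('a) - 1) * (\<integral>x. h x * ?p e x \<partial>lborel)
      + - (\<integral>x. (\<Sum>b\<in>Basis. h x * partial b (?f b) x) \<partial>lborel) - - (\<integral>x. h x * partial e ?g x \<partial>lborel)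
      = (\<integral>x. h x * ((real DIM('a) - 1) * ?p e x - (\<Sum>b\<in>Basis. partial b (?f b) x) + partial e ?g x) \<partial>lborel)"
    using hp i3 i4
    by (simp add: distrib_left right_diff_distrib sum_distrib_left mult.left_commute[of "h _" "real DIM('a) - 1"]
      del: right_diff_distrib_numeral)
  also have "\<dots> = 0" unfolding lap0 by simp
  finally show "(\<integral>x. stream_field e h H x \<bullet> grad \<phi> x \<partial>lborel) = 0" .
qed

section \<open>Integrability and the Lebesgue measure\<close>

lemma nn_integral_abs_powr_finite:
  fixes a :: real
  assumes "a < 1"
  shows "(\<integral>\<^sup>+y. ennreal (indicator {-1..1} y * \<bar>y\<bar> powr (-a)) \<partial>lborel) < \<infinity>"
proof -
  define f where "f y = (if y \<in> {0..1} then y powr (-a) else 0)" for y :: real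
  have [measurable]: "f \<in> borel_measurable borel" unfolding f_def by measurable
  have f0: "0 \<le> f y" for y by (simp add: f_def)
  have "(f has_integral (1 powr (-a + 1) / (-a + 1))) UNIV"
    unfolding f_def using has_integral_powr_from_0[of "-a" 1] assms
    by (simp only: has_integral_restrict_UNIV)
  from nn_integral_has_integral_lborel[OF _ f0 this]
  have I: "(\<integral>\<^sup>+y. ennreal (f y) \<partial>lborel) < \<infinity>"
    by (simp add: ennreal_less_top)
  \<comment> \<open>The two half-lines are handled by \<open>f\<close> and its reflection; the form
    \<open>0 + -1 * y\<close> matches the affine substitution rule used next.\<close>
  have "(\<integral>\<^sup>+y. ennreal (indicator {-1..1} y * \<bar>y\<bar> powr (-a)) \<partial>lborel)
      \<le> (\<integral>\<^sup>+y. ennreal (f y) + ennreal (f (0 + -1 * y)) \<partial>lborel)"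
    by (intro nn_integral_mono) (auto simp: f_def indicator_def simp flip: ennreal_plus)
  also have "\<dots> = (\<integral>\<^sup>+y. ennreal (f y) \<partial>lborel) + (\<integral>\<^sup>+y. ennreal (f (0 + -1 * y)) \<partial>lborel)"
    by (rule nn_integral_add) measurable
  also have "(\<integral>\<^sup>+y. ennreal (f (0 + -1 * y)) \<partial>lborel) = (\<integral>\<^sup>+y. ennreal (f y) \<partial>lborel)"
    by (subst nn_integral_real_affine[where c = "-1" and t = 0]) simp_all
  finally show ?thesis using I by (metis ennreal_add_less_top infinity_ennreal_def order.strict_trans1)
qed

text \<open>Since \<open>|x| \<ge> |x \<bullet> b|\<close> for each of the \<open>n\<close> coordinates, \<open>|x|\<^sup>-\<^sup>\<sigma>\<close> is at most the product of
  the factors \<open>|x \<bullet> b|\<^sup>-\<^sup>\<sigma>\<^sup>/\<^sup>n\<close>, and the integral factorises.\<close>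

lemma set_integrable_coordinate_norm_powr:
  fixes e :: "'a::euclidean_space"
  assumes e: "e \<in> Basis" and s: "0 \<le> s" and t: "0 \<le> t" and st: "t + s / DIM('a) < 1"
  shows "set_integrable lborel (ball 0 1) (\<lambda>x::'a. \<bar>x \<bullet> e\<bar> powr (-t) * norm x powr (-s))"
proof -
  let ?n = "real DIM('a)"
  \<comment> \<open>The exponent carried by coordinate \<open>b\<close>: an equal share of
    \<open>s\<close>, and for \<open>e\<close> the additional \<open>t\<close>. The assumption
    \<open>st\<close> bounds the largest of them by 1.\<close>
  define a where "a b = (if b = e then t else 0) + s / ?n" for b :: 'a
  define f where "f b y = indicator {-1..1} y * \<bar>y\<bar> powr (- a b)" for b :: 'a and y :: real
  have a1: "a b < 1" for b
  proof -
    have "s / ?n < 1" using st t by linarith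
    then show ?thesis using st unfolding a_def by (cases "b = e") (simp_all only: add.commute simp_thms if_True if_False add_0_right add_0)
  qed
  have bound: "indicator (ball 0 1) x * (\<bar>x \<bullet> e\<bar> powr (-t) * norm x powr (-s)) \<le> (\<Prod>b\<in>Basis. f b (x \<bullet> b))"
    if nz: "\<And>b. b \<in> Basis \<Longrightarrow> x \<bullet> b \<noteq> 0" for x :: 'a
  proof (cases "x \<in> ball 0 1")
    case True
    have le1: "\<bar>x \<bullet> b\<bar> \<le> 1" if "b \<in> Basis" for b
      using Basis_le_norm[OF that, of x] True by simp
    have x0: "x \<noteq> 0" using nz[OF e] by auto
    have "norm x powr (-s) = norm x powr (\<Sum>b\<in>(Basis::'a set). - (s / ?n))"
      by simp
    also have "\<dots> = (\<Prod>b\<in>(Basis::'a set). norm x powr (- (s / ?n)))"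
      using x0 by (subst powr_sum) auto
    also have "\<dots> \<le> (\<Prod>b\<in>Basis. \<bar>x \<bullet> b\<bar> powr (- (s / ?n)))"
      using nz s by (intro prod_mono conjI powr_mono2') (auto simp: Basis_le_norm)
    finally have "\<bar>x \<bullet> e\<bar> powr (-t) * norm x powr (-s)
        \<le> \<bar>x \<bullet> e\<bar> powr (-t) * (\<Prod>b\<in>Basis. \<bar>x \<bullet> b\<bar> powr (- (s / ?n)))"
      by (rule mult_left_mono) simp
    also have "\<bar>x \<bullet> e\<bar> powr (-t) = (\<Prod>b\<in>Basis. if b = e then \<bar>x \<bullet> b\<bar> powr (-t) else 1)"
      using e by simp
    also have "\<dots> * (\<Prod>b\<in>Basis. \<bar>x \<bullet> b\<bar> powr (- (s / ?n)))
        = (\<Prod>b\<in>Basis. (if b = e then \<bar>x \<bullet> b\<bar> powr (-t) else 1) * \<bar>x \<bullet> b\<bar> powr (- (s / ?n)))"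
      by (rule prod.distrib[symmetric])
    also have "\<dots> = (\<Prod>b\<in>Basis. f b (x \<bullet> b))"
      using le1 by (intro prod.cong) (auto simp: f_def a_def indicator_def abs_le_iff simp flip: powr_add)
    finally show ?thesis using True e by simp
  next
    case False
    then show ?thesis by (simp add: f_def prod_nonneg)
  qed
  have [measurable]: "f b \<in> borel_measurable borel" for b unfolding f_def by measurable
  have "(\<integral>\<^sup>+x. ennreal (indicator (ball 0 1) x * (\<bar>x \<bullet> e\<bar> powr (-t) * norm x powr (-s))) \<partial>lborel)
      \<le> (\<integral>\<^sup>+x. (\<Prod>b\<in>Basis. ennreal (f b (x \<bullet> b))) \<partial>(lborel :: 'a measure))"
  proof (rule nn_integral_mono_AE)
    \<comment> \<open>Points with a zero coordinate must be discarded: \<open>0 powr a\<close> is 0,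
      so there the product would vanish instead of being infinite.\<close>
    have "AE x in lborel. \<forall>b\<in>Basis. x \<bullet> b \<noteq> (0::real)"
      by (rule AE_finite_allI) (auto intro: AE_lborel_inner_Basis_ne)
    then show "AE x in lborel. ennreal (indicator (ball 0 1) x * (\<bar>x \<bullet> e\<bar> powr (-t) * norm x powr (-s)))
        \<le> (\<Prod>b\<in>Basis. ennreal (f b (x \<bullet> b)))"
    proof eventually_elim
      case (elim x)
      have "(\<Prod>b\<in>Basis. ennreal (f b (x \<bullet> b))) = ennreal (\<Prod>b\<in>Basis. f b (x \<bullet> b))"
        by (rule prod_ennreal) (simp add: f_def)
      then show ?case using bound[of x] elim by (simp add: ennreal_leI)
    qed
  qed
  also have "\<dots> = (\<Prod>b\<in>(Basis::'a set). \<integral>\<^sup>+y. ennreal (f b y) \<partial>lborel)"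
    by (rule nn_integral_lborel_prod) (auto simp: f_def)
  also have "\<dots> < \<infinity>"
    using nn_integral_abs_powr_finite[OF a1] unfolding f_def
    by (simp add: less_top[symmetric] ennreal_prod_eq_top)
  finally have fin: "(\<integral>\<^sup>+x. ennreal (indicator (ball 0 1) x * (\<bar>x \<bullet> e\<bar> powr (-t) * norm x powr (-s))) \<partial>(lborel :: 'a measure)) < \<infinity>" .
  show ?thesis unfolding set_integrable_def real_scaleR_def
    by (rule integrableI_nonneg) (use fin in \<open>measurable, auto\<close>)
qed

lemma set_borel_measurable_lebesgue:
  fixes f :: "'a::euclidean_space \<Rightarrow> 'b::euclidean_space"
  assumes "f \<in> borel_measurable borel" "S \<in> sets borel"
  shows "set_borel_measurable lebesgue S f"
proof -
  have "(\<lambda>x. indicator S x *\<^sub>R f x) \<in> borel_measurable lborel"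
    using assms by (intro borel_measurable_scaleR borel_measurable_indicator) auto
  then show ?thesis unfolding set_borel_measurable_def by (rule measurable_completion)
qed

lemma set_integrable_lebesgueI:
  fixes f :: "'a::euclidean_space \<Rightarrow> 'b::euclidean_space"
  assumes "set_integrable lborel S f"
  shows "set_integrable lebesgue S f"
  using assms integrable_completion[OF borel_measurable_integrable] unfolding set_integrable_def by blast

lemma set_integral_lebesgue_support:
  fixes f :: "'a::euclidean_space \<Rightarrow> real"
  assumes "integrable lborel f" "\<And>x. x \<notin> S \<Longrightarrow> f x = 0"
  shows "(LINT x:S|lebesgue. f x) = (\<integral>x. f x \<partial>lborel)"
proof -
  have "(\<lambda>x. indicator S x *\<^sub>R f x) = f"
    using assms(2) by (force simp: indicator_def fun_eq_iff)
  then show ?thesis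
    unfolding set_lebesgue_integral_def using integral_completion[OF borel_measurable_integrable[OF assms(1)]] by simp
qed

lemma locally_integrableI:
  fixes f :: "'a::euclidean_space \<Rightarrow> 'b::euclidean_space"
  assumes "set_integrable lborel S f"
  shows "locally_integrable S f"
  unfolding locally_integrable_def
proof (intro allI impI)
  fix K assume K: "compact K \<and> K \<subseteq> S"
  have "K \<in> sets lborel" using K by (simp add: borel_closed compact_imp_closed)
  then have "set_integrable lborel K f"
    using K by (intro set_integrable_subset[OF assms]) auto
  then show "set_integrable lebesgue K f" by (rule set_integrable_lebesgueI)
qed

lemma set_integrable_fst_cylinder:
  fixes f :: "'a::euclidean_space \<Rightarrow> 'b::euclidean_space"
  assumes "set_integrable lborel S f"
  shows "set_integrable lborel (S \<times> {a<..<b::real}) (\<lambda>(x, t). f x)"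
proof -
  let ?g = "\<lambda>x. indicator S x *\<^sub>R f x" and ?J = "{a<..<b}"
  have g: "integrable lborel ?g" using assms by (simp add: set_integrable_def)
  have [measurable]: "?g \<in> borel_measurable lborel" by (rule borel_measurable_integrable[OF g])
  have m: "(\<lambda>y. indicator ?J (snd y) *\<^sub>R ?g (fst y)) \<in> borel_measurable (lborel \<Otimes>\<^sub>M lborel)"
    by measurable
  have "integrable (lborel \<Otimes>\<^sub>M lborel) (\<lambda>y. indicator ?J (snd y) *\<^sub>R ?g (fst y))"
  proof (rule lborel_pair.Fubini_integrable[OF m])
    have "(\<integral>t. norm (indicator ?J (snd (x, t)) *\<^sub>R ?g (fst (x, t))) \<partial>lborel) = measure lborel ?J * norm (?g x)" for x
      by simp
    moreover have "integrable lborel (\<lambda>x. measure lborel ?J * norm (?g x))"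
      by (intro integrable_mult_right integrable_norm g)
    ultimately show "integrable lborel (\<lambda>x. \<integral>t. norm (indicator ?J (snd (x, t)) *\<^sub>R ?g (fst (x, t))) \<partial>lborel)"
      by (simp only:)
    show "AE x in lborel. integrable lborel (\<lambda>t. indicator ?J (snd (x, t)) *\<^sub>R ?g (fst (x, t)))"
      unfolding fst_conv snd_conv
      by (intro AE_I2 integrable_scaleR_left integrable_real_indicator emeasure_bounded_finite) auto
  qed
  moreover have "(\<lambda>y. indicator ?J (snd y) *\<^sub>R ?g (fst y)) = (\<lambda>y. indicator (S \<times> ?J) y *\<^sub>R (case y of (x, t) \<Rightarrow> f x))"
    by (auto simp: indicator_def fun_eq_iff)
  ultimately show ?thesis unfolding set_integrable_def lborel_prod by simp
qed

section \<open>Time slices of space-time test functions\<close>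

lemma partial_slice:
  fixes \<phi> :: "'a::euclidean_space \<times> 'b::euclidean_space \<Rightarrow> real"
  assumes "\<phi> differentiable (at (x, t))"
  shows "(\<lambda>y. \<phi> (y, t)) differentiable (at x)" "partial b (\<lambda>y. \<phi> (y, t)) x = partial (b, 0) \<phi> (x, t)"
proof -
  have "((\<lambda>y. (y, t)) has_derivative (\<lambda>h. (h, 0))) (at x)"
    by (intro derivative_eq_intros) auto
  moreover have "(\<phi> has_derivative frechet_derivative \<phi> (at (x, t))) (at (x, t))"
    using assms frechet_derivative_works by blast
  ultimately have "((\<lambda>y. \<phi> (y, t)) has_derivative (\<lambda>h. frechet_derivative \<phi> (at (x, t)) (h, 0))) (at x)"
    by (rule has_derivative_compose)
  from partial_eqI[OF this] this
  show "(\<lambda>y. \<phi> (y, t)) differentiable (at x)" "partial b (\<lambda>y. \<phi> (y, t)) x = partial (b, 0) \<phi> (x, t)"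
    by (auto simp: partial_def differentiable_def)
qed

lemma Basis_pair_left: "b \<in> Basis \<Longrightarrow> (b, 0) \<in> Basis"
  by (simp add: Basis_prod_def)

lemma C_k_slice:
  fixes \<phi> :: "'a::euclidean_space \<times> 'b::euclidean_space \<Rightarrow> real"
  shows "C_k k \<phi> \<Longrightarrow> C_k k (\<lambda>y. \<phi> (y, t))"
proof (induction k arbitrary: \<phi>)
  case 0
  then have "continuous_on UNIV \<phi>" by simp
  then have "continuous_on UNIV (\<lambda>y. \<phi> (y, t))"
    by (rule continuous_on_compose2) (auto intro!: continuous_intros)
  then show ?case by simp
next
  case (Suc k)
  have d: "\<phi> differentiable (at y)" for y using C_k_Suc_differentiable[OF Suc.prems] .
  have "C_k k (partial b (\<lambda>y. \<phi> (y, t)))" if "b \<in> Basis" for b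
  proof -
    have "C_k k (partial (b, 0) \<phi>)" using Suc.prems Basis_pair_left[OF that] by (subst (asm) C_k.simps(2)) blast
    moreover have "partial b (\<lambda>y. \<phi> (y, t)) = (\<lambda>x. partial (b, 0) \<phi> (x, t))"
      using partial_slice(2)[OF d] by (rule ext)
    ultimately show ?thesis using Suc.IH by simp
  qed
  then show ?case using partial_slice(1)[OF d] by (simp add: differentiable_on_def)
qed

text \<open>Used at the end to find points of prescribed open sets at which a representative really
  agrees with the solution.\<close>

lemma AE_lebesgue_open_witness:
  fixes U :: "'a::euclidean_space set"
  assumes "AE y in lebesgue. P y" "open U" "U \<noteq> {}"
  obtains y where "y \<in> U" "P y"
proof -
  obtain N where N: "N \<in> null_sets lebesgue" "{y. \<not> P y} \<subseteq> N"
    using assms(1) by (auto simp: eventually_ae_filter)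
  have "\<not> U \<subseteq> N"
    using N(1) open_not_negligible[OF assms(2,3)] negligible_subset negligible_iff_null_sets by blast
  then show thesis using N(2) that by blast
qed

section \<open>The drift and the solution\<close>

text \<open>The coefficient of x in \<open>stream_field_eta\<close>, cleared of z and of powers of
  B, with \<open>w\<close> for z^2 and \<open>k\<close> for 1/i. As \<open>R\<close>,
  \<open>w\<close> and \<open>rho\<close> are independent variables, monomials must match; the
  coefficient of \<open>R\<close> gives the fifth assumption.\<close>

lemma radial_coefficient:
  fixes i k j M L A y0 y1 R w rho :: real
  assumes "i * k = 1" "j = 2 - i" "M * y0 = j * L" "y1 * (M - 2 * k) = i"
    "2 = (1 + k) * j * L * y1 - (i - 1) * y0" "A = L + 1"
  shows "2 * k * (R + A * w * (rho - 1)) + (1 + k) * (y0 + L * y1 - A * y1 * rho) * (R + j * k * A * w - 2 * k * w)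
    = 2 * k * y0 * (R + A * w * (rho - 1)) - (1 + k) * (k * (y1 * R + (y0 - y1) * w)) * (2 + A * (i * rho - 2))"
  using assms by algebra

text \<open>The coefficient of e in the same vector identity. Its R^2 term forces
  \<open>y1 * (M - 2 * k) = i\<close>; with the other conditions, its w^2 term forces
  \<open>M * y0 = j * L\<close>.\<close>

lemma axial_coefficient:
  fixes i k j M L A y0 y1 R w rho :: real
  assumes "i * k = 1" "j = 2 - i" "M * y0 = j * L" "y1 * (M - 2 * k) = i"
    "2 = (1 + k) * j * L * y1 - (i - 1) * y0" "A = L + 1"
  shows "(R + j * k * A * w) * (R + A * w * (rho - 1)) + (1 + k) * w * (y0 + L * y1 - A * y1 * rho) * (R + j * k * A * w - 2 * k * R)
    = (M + 2) * (k * (y1 * R + (y0 - y1) * w)) * (R + A * w * (rho - 1)) - (1 + k) * (k * (y1 * R + (y0 - y1) * w)) * (2 * R + A * w * (i * rho - 2))"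
  using assms by algebra

text \<open>Writing |z|^a as (z^2)^(a/2) treats both signs of z at once.\<close>

lemma DERIV_abs_powr:
  fixes z a :: real
  assumes "z \<noteq> 0"
  shows "((\<lambda>z. \<bar>z\<bar> powr a) has_real_derivative a * \<bar>z\<bar> powr a / z) (at z)"
proof -
  have eq: "\<bar>y\<bar> powr a = (y\<^sup>2) powr (a / 2)" for y :: real
  proof -
    have "(y\<^sup>2) powr (a / 2) = (\<bar>y\<bar> powr 2) powr (a / 2)"
      by (cases "y = 0") (simp_all add: powr_numeral)
    then show ?thesis by (simp only: powr_powr) simp
  qed
  have "((\<lambda>y. (y\<^sup>2) powr (a / 2)) has_real_derivative a / 2 * (z\<^sup>2) powr (a / 2 - 1) * (2 * z)) (at z)"
    using assms by (auto intro!: derivative_eq_intros)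
  moreover have "a / 2 * (z\<^sup>2) powr (a / 2 - 1) * (2 * z) = a * \<bar>z\<bar> powr a / z"
    using assms by (simp add: eq powr_diff power2_eq_square)
  ultimately show ?thesis by (simp add: eq)
qed

text \<open>At 0 the absolute value is |z|^(1+a) with positive exponent. For a = -j this is what
  keeps the fields continuous across the plane although |z|^(-j) is not.\<close>

lemma isCont_mult_abs_powr:
  fixes z a :: real
  assumes "-1 < a"
  shows "isCont (\<lambda>z. z * \<bar>z\<bar> powr a) z"
proof (cases "z = 0")
  case True
  have "((\<lambda>z. \<bar>z\<bar>) \<longlongrightarrow> \<bar>0\<bar>) (at (0::real))"
    by (rule tendsto_rabs[OF tendsto_ident_at])
  then have "((\<lambda>z. \<bar>z\<bar> powr (1 + a)) \<longlongrightarrow> \<bar>0\<bar> powr (1 + a)) (at (0::real))"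
    by (rule tendsto_powr'[OF _ tendsto_const]) (use assms in simp)
  then have "((\<lambda>z. \<bar>z\<bar> powr (1 + a)) \<longlongrightarrow> 0) (at (0::real))" by simp
  moreover have "norm (z * \<bar>z\<bar> powr a) = \<bar>z\<bar> powr (1 + a)" for z :: real
    by (cases "z = 0") (simp_all add: abs_mult powr_add)
  ultimately have "((\<lambda>z. z * \<bar>z\<bar> powr a) \<longlongrightarrow> 0) (at (0::real))"
    by (subst tendsto_norm_zero_iff[symmetric]) simp
  then show ?thesis by (simp add: isCont_def True)
next
  case False
  then have "isCont (\<lambda>z. \<bar>z\<bar> powr a) z"
    by (intro DERIV_isCont[OF DERIV_abs_powr])
  then show ?thesis by (intro isCont_mult continuous_ident)
qed

text \<open>The second bound on \<open>j\<close> is j + (2 + j)/n < 1, the integrability condition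
  for |z|^(-j) |x|^(-2-j) on the ball, a majorant of the gradients of \<open>\<kappa>\<close> and
  \<open>h\<close>. A positive \<open>j\<close> can satisfy it because n > 2.\<close>

locale axial_inflow =
  fixes e :: "'a::euclidean_space" and j :: real
  assumes e: "e \<in> Basis" and dim: "3 \<le> DIM('a)"
    and j: "0 < j" "j * (real DIM('a) + 1) < real DIM('a) - 2"
begin

text \<open>\<open>L\<close>, \<open>y0\<close> and \<open>y1\<close> solve the linear conditions listed in \<open>parameters_rel\<close>, under
  which the two coefficient identities above hold.\<close>

definition i where "i = 2 - j"
definition M where "M = real DIM('a) - 1"
definition y0 where "y0 = (i * M - 2) / (i * M + i - 1)"
definition y1 where "y1 = i\<^sup>2 / (i * M - 2)"
definition L where "L = M * y0 / j"
definition A where "A = L + 1"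
definition \<beta> where "\<beta> = 1 + 1 / i"

lemma j1: "j < 1"
proof (rule ccontr)
  assume "\<not> j < 1"
  then have "1 * (real DIM('a) + 1) \<le> j * (real DIM('a) + 1)"
    by (intro mult_right_mono) auto
  from order.strict_trans1[OF this j(2)] show False by simp
qed

lemma i: "1 < i" "i < 2" "0 < i" "i \<noteq> 0" "j = 2 - i"
  using j1 j by (auto simp: i_def)

lemma M: "2 \<le> M" "2 < i * M"
proof -
  show "2 \<le> M" using dim by (simp add: M_def)
  have "i * 2 \<le> i * M" using i \<open>2 \<le> M\<close> by simp
  then show "2 < i * M" using i(1) by linarith
qed

lemma parameters_pos: "0 < y0" "0 < y1" "0 < L" "1 < A" "0 < \<beta>"
proof -
  show "0 < y0" using M i by (simp add: y0_def)
  show "0 < y1" using M i by (simp add: y1_def)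
  show L: "0 < L" using M j \<open>0 < y0\<close> by (simp add: L_def)
  show "1 < A" using L by (simp add: A_def)
  show "0 < \<beta>" using i by (simp add: \<beta>_def add_pos_pos)
qed

text \<open>The second condition replaces j L by M y0 in the last one, and the third fixes
  \<open>y1\<close>. The last then becomes linear in \<open>y0\<close>; the factor i M - 2 of
  \<open>y0\<close> cancels the denominator of \<open>y1\<close>, which leaves i M + i - 1.\<close>

lemma parameters_rel:
  "i * (1 / i) = 1" "M * y0 = j * L" "y1 * (M - 2 * (1 / i)) = i"
  "2 = (1 + 1 / i) * j * L * y1 - (i - 1) * y0"
proof -
  show "i * (1 / i) = 1" using i by simp
  show L: "M * y0 = j * L" using j by (simp add: L_def)
  have D: "i * M - 2 \<noteq> 0" "i * M + i - 1 \<noteq> 0" using M i by auto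
  show "y1 * (M - 2 * (1 / i)) = i"
    using D i by (simp add: y1_def field_simps power2_eq_square)
  have "(1 + 1 / i) * j * L * y1 - (i - 1) * y0 = (1 + 1 / i) * (M * y0) * y1 - (i - 1) * y0"
    by (simp add: L)
  also have "\<dots> = ((i + 1) * i * M - (i - 1) * (i * M - 2)) / (i * M + i - 1)"
    using D i unfolding y0_def y1_def by (simp add: divide_simps) (simp add: algebra_simps power2_eq_square)
  also have "\<dots> = 2"
    using D by (simp add: divide_simps) (simp add: algebra_simps)
  finally show "2 = (1 + 1 / i) * j * L * y1 - (i - 1) * y0" ..
qed

text \<open>The gradients below are the classical ones where \<open>x \<bullet> e \<noteq> 0\<close> and \<open>x\<close> is in the unit ball;
  for \<open>\<bar>x \<bullet> e\<bar> > 1\<close> the function \<open>B\<close> may fail to be positive.\<close>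

definition pw where "pw x = \<bar>x \<bullet> e\<bar> powr (- j)"

definition B where "B x = x \<bullet> x + A * (x \<bullet> e)\<^sup>2 * (pw x - 1)"
definition grad_B where "grad_B x = 2 *\<^sub>R x + (A * (x \<bullet> e) * (i * pw x - 2)) *\<^sub>R e"

definition V where "V x = (x \<bullet> e) * B x powr (- (1 / i))"
text \<open>The terms in rho cancel between B and (z/i) times the explicit z derivative of B,
  precisely because the exponent of B is -1/i. Hence a bound by a power of |x| alone is
  possible.\<close>

definition grad_V where
  "grad_V x = B x powr (- \<beta>) *\<^sub>R ((x \<bullet> x + j / i * A * (x \<bullet> e)\<^sup>2) *\<^sub>R e - (2 / i * (x \<bullet> e)) *\<^sub>R x)"

text \<open>As A = L + 1, one has z^2 (y0 + L y1 - A y1 rho) = (y1 |y|^2 + y0 z^2) - y1 B, whence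
  \<kappa> V = \<beta> (i \<eta> - y1 B^(-1/i)) in the ball away from the origin. Here rho occurs
  only as z rho, which is continuous.\<close>

definition \<kappa> where "\<kappa> x = \<beta> * (x \<bullet> e) * (y0 + L * y1 - A * y1 * pw x) / B x"
definition grad_\<kappa> where
  "grad_\<kappa> x = (\<beta> * (y0 + L * y1 - (1 - j) * (A * y1 * pw x)) / B x) *\<^sub>R e - (\<kappa> x / B x) *\<^sub>R grad_B x"

text \<open>Since |x|^2 = |y|^2 + z^2, the bracket is y1 |y|^2 + y0 z^2: an axisymmetric quadratic
  ansatz whose two constants are determined together with \<open>L\<close> by the coefficient
  identities.\<close>

definition \<eta> where "\<eta> x = (y1 * (x \<bullet> x) + (y0 - y1) * (x \<bullet> e)\<^sup>2) / i * B x powr (- \<beta>)"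
definition grad_\<eta> where
  "grad_\<eta> x = (B x powr (- \<beta>) / i) *\<^sub>R ((2 * y1) *\<^sub>R x + (2 * (y0 - y1) * (x \<bullet> e)) *\<^sub>R e)
     - (\<beta> * \<eta> x / B x) *\<^sub>R grad_B x"

definition h where "h x = \<kappa> x * V x - \<eta> x"
definition grad_h where "grad_h x = \<kappa> x *\<^sub>R grad_V x + V x *\<^sub>R grad_\<kappa> x - grad_\<eta> x"

definition u where "u = stream_field e \<kappa> grad_\<kappa>"

lemma measurable_fields [measurable]:
  "pw \<in> borel_measurable borel" "B \<in> borel_measurable borel" "grad_B \<in> borel_measurable borel"
  "V \<in> borel_measurable borel" "grad_V \<in> borel_measurable borel"
  "\<kappa> \<in> borel_measurable borel" "grad_\<kappa> \<in> borel_measurable borel"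
  "h \<in> borel_measurable borel" "grad_h \<in> borel_measurable borel"
  "u \<in> borel_measurable borel"
proof -
  show 1 [measurable]: "pw \<in> borel_measurable borel" unfolding pw_def[abs_def] by measurable
  show 2 [measurable]: "B \<in> borel_measurable borel" unfolding B_def[abs_def] by measurable
  show 3 [measurable]: "grad_B \<in> borel_measurable borel" unfolding grad_B_def[abs_def] by measurable
  show 4 [measurable]: "V \<in> borel_measurable borel" unfolding V_def[abs_def] by measurable
  show 5 [measurable]: "grad_V \<in> borel_measurable borel" unfolding grad_V_def[abs_def] by measurable
  show 6 [measurable]: "\<kappa> \<in> borel_measurable borel" unfolding \<kappa>_def[abs_def] by measurable
  show 7 [measurable]: "grad_\<kappa> \<in> borel_measurable borel" unfolding grad_\<kappa>_def[abs_def] by measurable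
  have 8 [measurable]: "\<eta> \<in> borel_measurable borel" unfolding \<eta>_def[abs_def] by measurable
  have 9 [measurable]: "grad_\<eta> \<in> borel_measurable borel" unfolding grad_\<eta>_def[abs_def] by measurable
  show "h \<in> borel_measurable borel" unfolding h_def[abs_def] by measurable
  show "grad_h \<in> borel_measurable borel" unfolding grad_h_def[abs_def] by measurable
  show "u \<in> borel_measurable borel" unfolding u_def stream_field_def[abs_def] by measurable
qed

lemma norm_e [simp]: "norm e = 1" and inner_e [simp]: "e \<bullet> e = 1"
  using e by simp_all

lemma abs_inner_e: "\<bar>x \<bullet> e\<bar> \<le> norm x"
  using e by (rule Basis_le_norm)

lemma square_inner_e: "(x \<bullet> e)\<^sup>2 \<le> x \<bullet> x"
  using abs_inner_e[of x] by (metis abs_le_square_iff abs_norm_cancel dot_square_norm)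

lemma pw_ge_1:
  assumes "x \<in> ball 0 1" "x \<bullet> e \<noteq> 0"
  shows "1 \<le> pw x"
proof -
  have "1 powr (- j) \<le> \<bar>x \<bullet> e\<bar> powr (- j)"
    using assms abs_inner_e[of x] j by (intro powr_mono2') auto
  then show ?thesis by (simp add: pw_def)
qed

text \<open>With A > 1 and rho >= 1 off the plane, B >= R + z^2 (rho - 1), and R >= z^2. The first
  bound turns negative powers of B into powers of |x|; the second, B >= |z|^i, makes V
  bounded.\<close>

lemma B_lower:
  assumes "x \<in> ball 0 1"
  shows "x \<bullet> x \<le> B x" "(x \<bullet> e)\<^sup>2 * pw x \<le> B x"
proof -
  have "0 \<le> (x \<bullet> e)\<^sup>2 * (pw x - 1)"
    using pw_ge_1[OF assms] by (cases "x \<bullet> e = 0") auto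
  then have 0: "(x \<bullet> e)\<^sup>2 * (pw x - 1) \<le> A * ((x \<bullet> e)\<^sup>2 * (pw x - 1))"
    using mult_right_mono[of 1 A "(x \<bullet> e)\<^sup>2 * (pw x - 1)"] parameters_pos(4) by simp
  with \<open>0 \<le> _\<close> show "x \<bullet> x \<le> B x" by (simp add: B_def mult.assoc)
  from 0 show "(x \<bullet> e)\<^sup>2 * pw x \<le> B x"
    using square_inner_e[of x] by (simp add: B_def mult.assoc right_diff_distrib)
qed

lemma B_pos:
  assumes "x \<in> ball 0 1" "x \<noteq> 0"
  shows "0 < B x"
  using B_lower(1)[OF assms(1)] assms(2) by (smt (verit) inner_gt_zero_iff)

lemma isCont_mult_pw: "isCont (\<lambda>x. (x \<bullet> e) * pw x) x"
proof -
  have "isCont (\<lambda>z. z * \<bar>z\<bar> powr (- j)) (x \<bullet> e)"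
    using j1 by (intro isCont_mult_abs_powr) simp
  then show ?thesis
    unfolding pw_def by (rule isCont_o2[rotated]) (intro continuous_intros)
qed

lemma isCont_B: "isCont B x"
proof -
  \<comment> \<open>Regrouped so that \<open>pw\<close>, which is discontinuous on the plane,
    appears only in the continuous product with x \<bullet> e.\<close>
  have "B = (\<lambda>x. x \<bullet> x + A * (x \<bullet> e) * ((x \<bullet> e) * pw x - x \<bullet> e))"
    by (auto simp: B_def fun_eq_iff power2_eq_square algebra_simps)
  moreover have "isCont (\<lambda>x. x \<bullet> x + A * (x \<bullet> e) * ((x \<bullet> e) * pw x - x \<bullet> e)) x"
    by (intro continuous_intros isCont_mult_pw)
  ultimately show ?thesis by simp
qed

lemma isCont_fields:
  assumes "x \<in> ball 0 1" "x \<noteq> 0"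
  shows "isCont V x" "isCont \<kappa> x" "isCont h x"
proof -
  have B: "B x \<noteq> 0" using B_pos[OF assms] by simp
  show V: "isCont V x"
    unfolding V_def[abs_def] by (intro continuous_intros isCont_B) (use B in auto)
  have "\<kappa> = (\<lambda>x. \<beta> * ((y0 + L * y1) * (x \<bullet> e) - A * y1 * ((x \<bullet> e) * pw x)) / B x)"
    by (auto simp: \<kappa>_def fun_eq_iff algebra_simps)
  moreover have "isCont (\<lambda>x. \<beta> * ((y0 + L * y1) * (x \<bullet> e) - A * y1 * ((x \<bullet> e) * pw x)) / B x) x"
    by (intro continuous_intros isCont_B isCont_mult_pw B)
  ultimately show \<kappa>: "isCont \<kappa> x" by simp
  have "isCont \<eta> x"
    unfolding \<eta>_def[abs_def] by (intro continuous_intros isCont_B) (use B i in auto)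
  then show "isCont h x"
    unfolding h_def[abs_def] by (intro continuous_intros V \<kappa>)
qed

lemma GDERIV_B:
  assumes "x \<bullet> e \<noteq> 0"
  shows "GDERIV pw x :> (- j * pw x / (x \<bullet> e)) *\<^sub>R e" "GDERIV B x :> grad_B x"
proof -
  have z: "GDERIV (\<lambda>x. x \<bullet> e) x :> e"
    unfolding gderiv_def by (auto intro!: derivative_eq_intros)
  have R: "GDERIV (\<lambda>x. x \<bullet> x) x :> 2 *\<^sub>R x"
    unfolding gderiv_def by (auto intro!: derivative_eq_intros simp: inner_commute)
  show pw: "GDERIV pw x :> (- j * pw x / (x \<bullet> e)) *\<^sub>R e"
    unfolding pw_def[abs_def]
    using GDERIV_DERIV_compose[OF z DERIV_abs_powr[OF assms, of "- j"]] by (simp add: pw_def)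
  have zz: "GDERIV (\<lambda>x. (x \<bullet> e)\<^sup>2) x :> (2 * (x \<bullet> e)) *\<^sub>R e"
    using GDERIV_mult[OF z z] by (simp add: power2_eq_square flip: scaleR_add_left)
  have "GDERIV B x :> 2 *\<^sub>R x + ((A * (x \<bullet> e)\<^sup>2) *\<^sub>R ((- j * pw x / (x \<bullet> e)) *\<^sub>R e - 0)
      + (pw x - 1) *\<^sub>R (A *\<^sub>R (2 * (x \<bullet> e)) *\<^sub>R e + (x \<bullet> e)\<^sup>2 *\<^sub>R 0))"
    unfolding B_def[abs_def]
    by (intro GDERIV_add GDERIV_mult GDERIV_diff R zz pw GDERIV_const)
  then show "GDERIV B x :> grad_B x"
  proof (rule GDERIV_subst)
    have "A * (x \<bullet> e)\<^sup>2 * (- j * pw x / (x \<bullet> e)) + (pw x - 1) * (A * (2 * (x \<bullet> e)))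
        = A * (x \<bullet> e) * (i * pw x - 2)"
      using assms by (simp add: i_def power2_eq_square field_simps)
    then show "2 *\<^sub>R x + ((A * (x \<bullet> e)\<^sup>2) *\<^sub>R ((- j * pw x / (x \<bullet> e)) *\<^sub>R e - 0)
      + (pw x - 1) *\<^sub>R (A *\<^sub>R (2 * (x \<bullet> e)) *\<^sub>R e + (x \<bullet> e)\<^sup>2 *\<^sub>R 0)) = grad_B x"
      by (simp add: grad_B_def flip: scaleR_add_left scaleR_diff_left)
  qed
qed

lemma GDERIV_B_powr:
  assumes "x \<in> ball 0 1" "x \<bullet> e \<noteq> 0"
  shows "GDERIV (\<lambda>x. B x powr a) x :> (a * B x powr (a - 1)) *\<^sub>R grad_B x"
proof (rule GDERIV_DERIV_compose[OF GDERIV_B(2)[OF assms(2)]])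
  have "x \<noteq> 0" using assms by auto
  then show "DERIV (\<lambda>b. b powr a) (B x) :> a * B x powr (a - 1)"
    using B_pos assms(1) by (intro has_real_derivative_powr) auto
qed

lemma B_powr_eq:
  assumes "x \<in> ball 0 1" "x \<bullet> e \<noteq> 0"
  shows "B x powr (- (1 / i)) = B x * B x powr (- \<beta>)" "B x powr (- \<beta> - 1) = B x powr (- \<beta>) / B x"
proof -
  have "x \<noteq> 0" using assms by auto
  then have B: "0 < B x" using B_pos assms(1) by auto
  have "B x powr (- (1 / i)) = B x powr (1 + - \<beta>)" by (simp add: \<beta>_def)
  also have "\<dots> = B x * B x powr (- \<beta>)" using B by (subst powr_add) simp
  finally show "B x powr (- (1 / i)) = B x * B x powr (- \<beta>)" .
  show "B x powr (- \<beta> - 1) = B x powr (- \<beta>) / B x" using B by (simp add: powr_diff)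
qed

lemma GDERIV_inner_e: "GDERIV (\<lambda>x. x \<bullet> e) x :> e"
  unfolding gderiv_def by (auto intro!: derivative_eq_intros)

lemma GDERIV_fields:
  assumes x: "x \<in> ball 0 1" "x \<bullet> e \<noteq> 0"
  shows "GDERIV V x :> grad_V x" "GDERIV \<kappa> x :> grad_\<kappa> x" "GDERIV h x :> grad_h x"
proof -
  have x0: "x \<noteq> 0" using x by auto
  have Bp: "0 < B x" using B_pos x x0 by blast
  let ?z = "x \<bullet> e" and ?P = "B x powr (- \<beta>)"
  have exp: "- (1 / i) - 1 = - \<beta>" by (simp add: \<beta>_def)
  have ik: "i * (1 / i) = 1" by (rule parameters_rel(1))
  show V: "GDERIV V x :> grad_V x"
    unfolding V_def[abs_def]
  proof (rule GDERIV_subst[OF GDERIV_mult[OF GDERIV_inner_e GDERIV_B_powr[OF x]]])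
    \<comment> \<open>Pairing with an arbitrary vector turns the vector identity into a polynomial
      one; \<open>c\<close> and \<open>d\<close> stand for the inner products of that vector with x
      and e.\<close>
    have coeff: "?z * (- k * P * (2 * c + A * ?z * (i * pw x - 2) * d)) + (B x * P) * d
        = P * ((x \<bullet> x + j * k * A * ?z\<^sup>2) * d - 2 * k * ?z * c)"
      if "i * k = 1" for k P c d
      using that i(5) unfolding B_def by algebra
    show "?z *\<^sub>R (- (1 / i) * B x powr (- (1 / i) - 1)) *\<^sub>R grad_B x + B x powr (- (1 / i)) *\<^sub>R e = grad_V x"
      unfolding exp B_powr_eq(1)[OF x]
    proof (rule vector_eq_rdot[THEN iffD1], rule allI)
      fix y
      show "(?z *\<^sub>R (- (1 / i) * ?P) *\<^sub>R grad_B x + (B x * ?P) *\<^sub>R e) \<bullet> y = grad_V x \<bullet> y"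
        using coeff[OF ik, of ?P "x \<bullet> y" "e \<bullet> y"]
        by (simp add: grad_B_def grad_V_def inner_add_left inner_diff_left)
    qed
  qed
  let ?N = "\<lambda>x. \<beta> * (x \<bullet> e) * (y0 + L * y1 - A * y1 * pw x)"
  have N: "GDERIV ?N x :> (\<beta> * (y0 + L * y1 - (1 - j) * (A * y1 * pw x))) *\<^sub>R e"
  proof (rule GDERIV_subst)
    show "GDERIV ?N x :> (\<beta> * ?z) *\<^sub>R (0 - ((A * y1) *\<^sub>R ((- j * pw x / ?z) *\<^sub>R e) + pw x *\<^sub>R 0))
       + (y0 + L * y1 - A * y1 * pw x) *\<^sub>R (\<beta> *\<^sub>R e + ?z *\<^sub>R 0)"
      by (intro GDERIV_mult GDERIV_diff GDERIV_const GDERIV_B GDERIV_inner_e x)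
    have "\<beta> * ?z * (A * y1 * (j * pw x / ?z)) + (y0 + L * y1 - A * y1 * pw x) * \<beta>
        = \<beta> * (y0 + L * y1 - (1 - j) * (A * y1 * pw x))"
      using x(2) by (simp add: field_simps)
    then show "(\<beta> * ?z) *\<^sub>R (0 - ((A * y1) *\<^sub>R ((- j * pw x / ?z) *\<^sub>R e) + pw x *\<^sub>R 0))
       + (y0 + L * y1 - A * y1 * pw x) *\<^sub>R (\<beta> *\<^sub>R e + ?z *\<^sub>R 0)
       = (\<beta> * (y0 + L * y1 - (1 - j) * (A * y1 * pw x))) *\<^sub>R e"
      by (simp flip: scaleR_add_left)
  qed
  have inv: "GDERIV (\<lambda>x. inverse (B x)) x :> - (inverse (B x))\<^sup>2 *\<^sub>R grad_B x"
    using Bp by (intro GDERIV_inverse GDERIV_B x) auto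
  show \<kappa>: "GDERIV \<kappa> x :> grad_\<kappa> x"
    unfolding \<kappa>_def[abs_def] divide_inverse[of _ "B _"]
    by (rule GDERIV_subst[OF GDERIV_mult[OF N inv]])
      (simp add: grad_\<kappa>_def \<kappa>_def divide_inverse power2_eq_square mult_ac)
  let ?Q = "\<lambda>x. (y1 * (x \<bullet> x) + (y0 - y1) * (x \<bullet> e)\<^sup>2) / i"
  have Q: "GDERIV ?Q x :> (1 / i) *\<^sub>R ((2 * y1) *\<^sub>R x + (2 * (y0 - y1) * ?z) *\<^sub>R e)"
    unfolding gderiv_def
    by (auto intro!: derivative_eq_intros simp: inner_commute inner_add_right) (use i in \<open>simp add: field_simps\<close>)
  have "GDERIV \<eta> x :> grad_\<eta> x"
    unfolding \<eta>_def[abs_def]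
    by (rule GDERIV_subst[OF GDERIV_mult[OF Q GDERIV_B_powr[OF x]]])
      (simp add: grad_\<eta>_def \<eta>_def B_powr_eq(2)[OF x] mult_ac)
  then show "GDERIV h x :> grad_h x"
    unfolding h_def[abs_def] grad_h_def
    by (intro GDERIV_diff GDERIV_mult V \<kappa>)
qed

text \<open>The left-hand side is the flux obtained by moving the derivatives of \<open>\<kappa>\<close> onto \<open>V\<close>; that it is
  again a stream field is the divergence form of \<open>u \<bullet> \<nabla>V = \<Delta>V\<close>.\<close>

lemma stream_field_eta:
  assumes x: "x \<in> ball 0 1" "x \<bullet> e \<noteq> 0"
  shows "grad_V x + \<kappa> x *\<^sub>R ((x \<bullet> grad_V x) *\<^sub>R e - (e \<bullet> grad_V x) *\<^sub>R x) = stream_field e \<eta> grad_\<eta> x"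
proof -
  have x0: "x \<noteq> 0" using x by auto
  have Bp: "0 < B x" using B_pos x x0 by blast
  let ?z = "x \<bullet> e" and ?P = "B x powr (- \<beta>)" and ?R = "x \<bullet> x" and ?k = "1 / i"
  let ?c = "y0 + L * y1 - A * y1 * pw x"
  define q where "q = ?k * (y1 * ?R + (y0 - y1) * ?z\<^sup>2)"
  have B: "B x = ?R + A * ?z\<^sup>2 * (pw x - 1)" by (simp add: B_def)
  have \<beta>: "1 + ?k = \<beta>" by (simp add: \<beta>_def)
  have zz: "?z\<^sup>2 = ?z * ?z" by (simp add: power2_eq_square)
  have ax: "(?R + j * ?k * A * ?z\<^sup>2) * B x + \<beta> * ?z\<^sup>2 * ?c * (?R + j * ?k * A * ?z\<^sup>2 - 2 * ?k * ?R)
      = (M + 2) * q * B x - \<beta> * q * (2 * ?R + A * ?z\<^sup>2 * (i * pw x - 2))"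
    using axial_coefficient[OF parameters_rel(1) i(5) parameters_rel(2-4) A_def, of ?R "?z\<^sup>2" "pw x"]
    unfolding B q_def \<beta>[symmetric] .
  have ra: "2 * ?k * B x + \<beta> * ?c * (?R + j * ?k * A * ?z\<^sup>2 - 2 * ?k * ?z\<^sup>2)
      = 2 * ?k * y0 * B x - \<beta> * q * (2 + A * (i * pw x - 2))"
    using radial_coefficient[OF parameters_rel(1) i(5) parameters_rel(2-4) A_def, of ?R "?z\<^sup>2" "pw x"]
    unfolding B q_def \<beta>[symmetric] .
  define v where "v = ?R + j / i * A * ?z\<^sup>2"
  have \<eta>: "\<eta> x = q * ?P" by (simp add: \<eta>_def q_def)
  have \<kappa>B: "\<kappa> x * B x = \<beta> * ?z * ?c" using Bp by (simp add: \<kappa>_def)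
  have ex: "e \<bullet> x = ?z" by (simp add: inner_commute)
  have gV: "x \<bullet> grad_V x = ?P * (v * ?z - 2 * ?k * ?z * ?R)" "e \<bullet> grad_V x = ?P * (v - 2 * ?k * ?z * ?z)"
    by (simp_all add: grad_V_def v_def inner_diff_right ex)
  have gB: "x \<bullet> grad_B x = 2 * ?R + A * ?z\<^sup>2 * (i * pw x - 2)" "e \<bullet> grad_B x = 2 * ?z + A * ?z * (i * pw x - 2)"
    by (simp_all add: grad_B_def inner_add_right ex power2_eq_square)
  have g\<eta>: "x \<bullet> grad_\<eta> x = 2 * q * ?P - \<beta> * q * ?P / B x * (x \<bullet> grad_B x)"
    "e \<bullet> grad_\<eta> x = 2 * ?k * y0 * ?z * ?P - \<beta> * q * ?P / B x * (e \<bullet> grad_B x)"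
    using i by (simp_all add: grad_\<eta>_def inner_diff_right inner_add_right ex \<eta> q_def field_simps power2_eq_square)
  \<comment> \<open>\<open>E\<close> and \<open>F\<close> compare the coefficients of e and x.
    Multiplication by B > 0 clears the denominators and leaves the polynomial identities
    \<open>ax\<close> and \<open>ra\<close>.\<close>
  have E: "?P * v + \<kappa> x * (x \<bullet> grad_V x) = M * \<eta> x + x \<bullet> grad_\<eta> x"
  proof -
    have "(?P * v + \<kappa> x * (x \<bullet> grad_V x)) * B x = ?P * (v * B x + (\<kappa> x * B x) * (v * ?z - 2 * ?k * ?z * ?R))"
      unfolding gV by algebra
    also have "\<dots> = ?P * ((?R + j * ?k * A * ?z\<^sup>2) * B x + \<beta> * ?z\<^sup>2 * ?c * (?R + j * ?k * A * ?z\<^sup>2 - 2 * ?k * ?R))"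
      unfolding \<kappa>B v_def zz by (simp add: algebra_simps)
    also have "\<dots> = ?P * ((M + 2) * q * B x - \<beta> * q * (x \<bullet> grad_B x))"
      unfolding ax gB ..
    also have "\<dots> = (M * \<eta> x + x \<bullet> grad_\<eta> x) * B x"
      unfolding g\<eta> \<eta> using Bp by (simp add: field_simps)
    finally show ?thesis using Bp by simp
  qed
  have F: "- ?P * (2 * ?k * ?z) - \<kappa> x * (e \<bullet> grad_V x) = - (e \<bullet> grad_\<eta> x)"
  proof -
    have "(?P * (2 * ?k * ?z) + \<kappa> x * (e \<bullet> grad_V x)) * B x
        = ?P * (2 * ?k * ?z * B x + (\<kappa> x * B x) * (v - 2 * ?k * ?z * ?z))"
      unfolding gV by algebra
    also have "\<dots> = ?P * ?z * (2 * ?k * B x + \<beta> * ?c * (?R + j * ?k * A * ?z\<^sup>2 - 2 * ?k * ?z\<^sup>2))"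
      unfolding \<kappa>B v_def zz by (simp add: algebra_simps)
    also have "\<dots> = ?P * (2 * ?k * y0 * ?z * B x - \<beta> * q * (e \<bullet> grad_B x))"
      unfolding ra gB by (simp add: algebra_simps)
    also have "\<dots> = (e \<bullet> grad_\<eta> x) * B x"
      unfolding g\<eta> using Bp by (simp add: field_simps)
    finally have "?P * (2 * ?k * ?z) + \<kappa> x * (e \<bullet> grad_V x) = e \<bullet> grad_\<eta> x" using Bp by simp
    then show ?thesis by simp
  qed
  have "grad_V x + \<kappa> x *\<^sub>R ((x \<bullet> grad_V x) *\<^sub>R e - (e \<bullet> grad_V x) *\<^sub>R x)
      = (?P * v + \<kappa> x * (x \<bullet> grad_V x)) *\<^sub>R e + (- ?P * (2 * ?k * ?z) - \<kappa> x * (e \<bullet> grad_V x)) *\<^sub>R x"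
    by (subst grad_V_def) (simp add: v_def scaleR_diff_right scaleR_add_left scaleR_diff_left scaleR_add_right distrib_left)
  also have "\<dots> = stream_field e \<eta> grad_\<eta> x"
    unfolding E F stream_field_def M_def by simp
  finally show ?thesis .
qed

text \<open>\<open>stream_field\<close> is a first-order operator, so on the product \<kappa> V it
  gives V u plus \<kappa> times the derivative terms of V. By \<open>stream_field_eta\<close> these
  are the stream field of \<eta> minus grad V.\<close>

lemma V_u:
  assumes x: "x \<in> ball 0 1" "x \<bullet> e \<noteq> 0"
  shows "V x *\<^sub>R u x = stream_field e h grad_h x + grad_V x"
proof -
  have "stream_field e h grad_h x
      = V x *\<^sub>R u x + \<kappa> x *\<^sub>R ((x \<bullet> grad_V x) *\<^sub>R e - (e \<bullet> grad_V x) *\<^sub>R x) - stream_field e \<eta> grad_\<eta> x"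
    by (rule vector_eq_rdot[THEN iffD1], rule allI)
      (simp add: stream_field_def u_def h_def grad_h_def inner_add_left inner_diff_left
        inner_add_right inner_diff_right algebra_simps)
  then show ?thesis by (simp flip: stream_field_eta[OF x])
qed

subsection \<open>Estimates\<close>

text \<open>For rho >= 1 and 0 <= s <= 1, \<open>c\<close> times rho bounds |y0 + L y1 - s A y1
  rho|; s = 1 occurs in \<open>\<kappa>\<close> and s = 1 - j in its gradient.\<close>

definition c where "c = y0 + L * y1 + A * y1"

lemma c_pos: "0 < c"
  using parameters_pos by (simp add: c_def add_pos_pos)

text \<open>The second estimate is the sharper one: with a factor |z|, the gradient of B is
  controlled by B itself, without loss of rho. It applies to \<open>\<kappa>\<close>, whose
  numerator carries that factor.\<close>

lemma
  assumes x: "x \<in> ball 0 1" "x \<bullet> e \<noteq> 0"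
  shows norm_grad_B: "norm (grad_B x) \<le> (2 + 4 * A) * (norm x * pw x)"
    and inner_e_grad_B: "\<bar>x \<bullet> e\<bar> * norm (grad_B x) \<le> (2 + 4 * A) * B x"
proof -
  have p: "1 \<le> pw x" by (rule pw_ge_1[OF x])
  have ip: "0 \<le> i * pw x" "i * pw x \<le> 2 * pw x"
    using i p by (auto intro!: mult_right_mono)
  have ip4: "\<bar>i * pw x - 2\<bar> \<le> 4 * pw x" unfolding abs_le_iff using ip p by linarith
  have A0: "0 \<le> A" using parameters_pos by simp
  have "norm (grad_B x) \<le> 2 * norm x + \<bar>A * (x \<bullet> e) * (i * pw x - 2)\<bar>"
    unfolding grad_B_def by (rule norm_triangle_le) simp
  also have "\<bar>A * (x \<bullet> e) * (i * pw x - 2)\<bar> = A * \<bar>x \<bullet> e\<bar> * \<bar>i * pw x - 2\<bar>"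
    using A0 by (simp add: abs_mult)
  also have "\<dots> \<le> A * \<bar>x \<bullet> e\<bar> * (4 * pw x)"
    using A0 ip4 by (intro mult_left_mono) auto
  finally have N: "norm (grad_B x) \<le> 2 * norm x + A * \<bar>x \<bullet> e\<bar> * (4 * pw x)" by simp
  also have "\<dots> \<le> 2 * (norm x * pw x) + A * norm x * (4 * pw x)"
    using p A0 abs_inner_e[of x] by (intro add_mono mult_left_mono mult_right_mono) (auto simp: mult_le_cancel_left1)
  finally show "norm (grad_B x) \<le> (2 + 4 * A) * (norm x * pw x)" by (simp add: algebra_simps)
  have zz: "(x \<bullet> e)\<^sup>2 = \<bar>x \<bullet> e\<bar> * \<bar>x \<bullet> e\<bar>" by (simp add: power2_eq_square)
  have "\<bar>x \<bullet> e\<bar> * norm (grad_B x) \<le> \<bar>x \<bullet> e\<bar> * (2 * norm x + A * \<bar>x \<bullet> e\<bar> * (4 * pw x))"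
    by (rule mult_left_mono[OF N]) simp
  also have "\<dots> = 2 * (\<bar>x \<bullet> e\<bar> * norm x) + 4 * A * ((x \<bullet> e)\<^sup>2 * pw x)"
    unfolding zz by (simp add: algebra_simps)
  also have "\<dots> \<le> 2 * B x + 4 * A * B x"
  proof (intro add_mono mult_left_mono B_lower(2) x)
    have "\<bar>x \<bullet> e\<bar> * norm x \<le> norm x * norm x"
      using abs_inner_e by (rule mult_right_mono) simp
    then show "\<bar>x \<bullet> e\<bar> * norm x \<le> B x"
      using B_lower(1)[OF x(1)] by (simp add: dot_square_norm power2_eq_square)
  qed (use A0 in auto)
  finally show "\<bar>x \<bullet> e\<bar> * norm (grad_B x) \<le> (2 + 4 * A) * B x" by (simp add: algebra_simps)
qed

lemma divide_B_le:
  assumes x: "x \<in> ball 0 1" "x \<noteq> 0"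
  shows "(norm x)\<^sup>2 / B x \<le> 1"
  using B_lower(1)[OF x(1)] B_pos[OF x] by (simp add: dot_square_norm)

lemma kappa_bounds:
  assumes x: "x \<in> ball 0 1" "x \<bullet> e \<noteq> 0"
  shows "\<bar>\<kappa> x\<bar> \<le> \<beta> * c * (3 + 4 * A) * (pw x / norm x)"
    and "norm (grad_\<kappa> x) \<le> \<beta> * c * (3 + 4 * A) * (pw x / (norm x)\<^sup>2)"
proof -
  have p: "1 \<le> pw x" by (rule pw_ge_1[OF x])
  have x0: "x \<noteq> 0" using x by auto
  have B: "0 < B x" by (rule B_pos[OF x(1) x0])
  note pos = parameters_pos c_pos
  have Ay: "0 < A * y1" "0 < L * y1" using pos by simp_all
  have yL: "0 < y0 + L * y1" using pos Ay by linarith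
  have d: "\<bar>y0 + L * y1 - s * (A * y1 * pw x)\<bar> \<le> c * pw x" if "0 \<le> s" "s \<le> 1" for s
  proof -
    have "s * (A * y1 * pw x) \<le> 1 * (A * y1 * pw x)" "0 \<le> s * (A * y1 * pw x)"
      using that pos p by (intro mult_right_mono mult_nonneg_nonneg; simp)+
    moreover have "y0 + L * y1 \<le> (y0 + L * y1) * pw x"
      using p yL by (simp add: mult_le_cancel_left1)
    moreover have "0 \<le> (y0 + L * y1) * pw x" using p yL by simp
    moreover have "0 \<le> y0 + L * y1" using pos Ay by simp
    ultimately show ?thesis by (simp add: c_def distrib_right)
  qed
  have \<kappa>: "\<bar>\<kappa> x\<bar> \<le> \<beta> * c * pw x * \<bar>x \<bullet> e\<bar> / B x"
  proof -
    have "\<bar>\<kappa> x\<bar> = \<beta> * \<bar>x \<bullet> e\<bar> * \<bar>y0 + L * y1 - 1 * (A * y1 * pw x)\<bar> / B x"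
      using pos B by (simp add: \<kappa>_def abs_mult)
    also have "\<dots> \<le> \<beta> * \<bar>x \<bullet> e\<bar> * (c * pw x) / B x"
      using pos B by (intro divide_right_mono mult_left_mono d) auto
    finally show ?thesis by (simp add: mult_ac)
  qed
  have pB: "pw x / B x \<le> pw x / (norm x)\<^sup>2"
    using B_lower(1)[OF x(1)] p x0 by (intro divide_left_mono) (auto simp: dot_square_norm B)
  have K: "\<beta> * c \<le> \<beta> * c * (3 + 4 * A)" "0 \<le> \<beta> * c"
    using mult_left_mono[of 1 "3 + 4 * A" "\<beta> * c"] pos by simp_all
  have "\<bar>\<kappa> x\<bar> \<le> \<beta> * c * pw x * norm x / B x"
    using abs_inner_e[of x] pos p B by (intro order.trans[OF \<kappa>] divide_right_mono mult_left_mono) auto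
  also have "\<dots> = \<beta> * c * norm x * (pw x / B x)" by simp
  also have "\<dots> \<le> \<beta> * c * norm x * (pw x / (norm x)\<^sup>2)"
    using K by (intro mult_left_mono pB) auto
  also have "\<dots> = \<beta> * c * (pw x / norm x)"
    using x0 by (simp add: power2_eq_square)
  also have "\<dots> \<le> \<beta> * c * (3 + 4 * A) * (pw x / norm x)"
    using p by (intro mult_right_mono K) auto
  finally show "\<bar>\<kappa> x\<bar> \<le> \<beta> * c * (3 + 4 * A) * (pw x / norm x)" .
  have "norm (grad_\<kappa> x) \<le> \<beta> * \<bar>y0 + L * y1 - (1 - j) * (A * y1 * pw x)\<bar> / B x + \<bar>\<kappa> x\<bar> / B x * norm (grad_B x)"
    unfolding grad_\<kappa>_def using pos B by (intro norm_triangle_le_diff) (simp add: abs_mult)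
  also have "\<dots> \<le> \<beta> * (c * pw x) / B x + (\<beta> * c * pw x * \<bar>x \<bullet> e\<bar> / B x) / B x * norm (grad_B x)"
    using pos B j j1 by (intro add_mono divide_right_mono mult_left_mono mult_right_mono d \<kappa>) auto
  also have "(\<beta> * c * pw x * \<bar>x \<bullet> e\<bar> / B x) / B x * norm (grad_B x)
      = \<beta> * c * pw x / (B x * B x) * (\<bar>x \<bullet> e\<bar> * norm (grad_B x))" by simp
  also have "\<dots> \<le> \<beta> * c * pw x / (B x * B x) * ((2 + 4 * A) * B x)"
    using pos B p by (intro mult_left_mono inner_e_grad_B x) auto
  also have "\<beta> * (c * pw x) / B x + \<beta> * c * pw x / (B x * B x) * ((2 + 4 * A) * B x)
      = \<beta> * c * (3 + 4 * A) * (pw x / B x)"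
    using B by (simp add: field_simps)
  also have "\<dots> \<le> \<beta> * c * (3 + 4 * A) * (pw x / (norm x)\<^sup>2)"
    using K by (intro mult_left_mono pB) auto
  finally show "norm (grad_\<kappa> x) \<le> \<beta> * c * (3 + 4 * A) * (pw x / (norm x)\<^sup>2)" by simp
qed

lemma u_bound:
  assumes x: "x \<in> ball 0 1" "x \<bullet> e \<noteq> 0"
  shows "norm (u x) \<le> (M + 2) * (\<beta> * c * (3 + 4 * A)) * (pw x / norm x)"
proof -
  have x0: "x \<noteq> 0" using x by auto
  let ?K = "\<beta> * c * (3 + 4 * A)"
  have g: "norm x * norm (grad_\<kappa> x) \<le> ?K * (pw x / norm x)"
  proof -
    have "norm x * norm (grad_\<kappa> x) \<le> norm x * (?K * (pw x / (norm x)\<^sup>2))"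
      by (intro mult_left_mono kappa_bounds x) simp
    also have "\<dots> = ?K * (pw x / norm x)" using x0 by (simp add: power2_eq_square)
    finally show ?thesis .
  qed
  have "norm (u x) \<le> \<bar>M * \<kappa> x + x \<bullet> grad_\<kappa> x\<bar> + \<bar>e \<bullet> grad_\<kappa> x\<bar> * norm x"
    unfolding u_def stream_field_def M_def by (intro norm_triangle_le_diff) simp
  also have "\<dots> \<le> (M * \<bar>\<kappa> x\<bar> + norm x * norm (grad_\<kappa> x)) + norm (grad_\<kappa> x) * norm x"
    using Cauchy_Schwarz_ineq2[of x "grad_\<kappa> x"] Cauchy_Schwarz_ineq2[of e "grad_\<kappa> x"] M(1)
    by (intro add_mono mult_right_mono order.trans[OF abs_triangle_ineq]) (auto simp: abs_mult)
  also have "\<dots> \<le> (M * (?K * (pw x / norm x)) + ?K * (pw x / norm x)) + ?K * (pw x / norm x)"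
    using g M(1) by (intro add_mono mult_left_mono kappa_bounds x) (auto simp: mult.commute)
  also have "\<dots> = (M + 2) * ?K * (pw x / norm x)" by (simp only: distrib_right)
  finally show ?thesis .
qed

text \<open>B >= |x|^2 gives B^(-\<beta>) |x|^2 <= |x|^(-2/i). This exponent and -1 are both
  replaced by the weaker -(1 + j), so that one power serves all fields.\<close>

lemma norm_powr_bound:
  assumes x: "x \<in> ball 0 1" "x \<noteq> 0"
  shows "1 / norm x \<le> norm x powr (- (1 + j))"
    "B x powr (- \<beta>) * (norm x)\<^sup>2 \<le> norm x powr (- (1 + j))"
    "norm x powr (- (1 + j)) / norm x = norm x powr (- (2 + j))"
proof -
  have r: "0 < norm x" "norm x < 1" using x by auto
  have "norm x powr (- 1) \<le> norm x powr (- (1 + j))"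
    using r j by (intro powr_mono') auto
  then show "1 / norm x \<le> norm x powr (- (1 + j))"
    using r by (simp add: powr_minus_divide)
  have "B x powr (- \<beta>) \<le> ((norm x)\<^sup>2) powr (- \<beta>)"
    using B_lower(1)[OF x(1)] r parameters_pos by (intro powr_mono2') (auto simp: dot_square_norm)
  also have "\<dots> = norm x powr (2 * - \<beta>)"
  proof -
    have "(norm x)\<^sup>2 = norm x powr 2" using r by (simp add: powr_numeral)
    then show ?thesis by (simp only: powr_powr)
  qed
  finally have "B x powr (- \<beta>) * (norm x)\<^sup>2 \<le> norm x powr (2 * - \<beta>) * (norm x)\<^sup>2"
    by (rule mult_right_mono) simp
  also have "\<dots> = norm x powr (2 * - \<beta>) * norm x powr 2" using r by (simp add: powr_numeral)
  also have "\<dots> = norm x powr (2 * - \<beta> + 2)" by (rule powr_add[symmetric])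
  also have "\<dots> = norm x powr (- (2 / i))" by (simp add: \<beta>_def)
  also have "\<dots> \<le> norm x powr (- (1 + j))"
  proof -
    \<comment> \<open>Equivalent to 2 <= (1 + j)(2 - j).\<close>
    have "0 \<le> j * (1 - j)" using j j1 by simp
    then have "2 / i \<le> 1 + j" using i by (simp add: i_def field_simps)
    then show ?thesis using r by (intro powr_mono') auto
  qed
  finally show "B x powr (- \<beta>) * (norm x)\<^sup>2 \<le> norm x powr (- (1 + j))" .
  have "norm x powr (- (1 + j)) / norm x = norm x powr (- (1 + j)) / norm x powr 1" using r by simp
  also have "\<dots> = norm x powr (- (1 + j) - 1)" by (rule powr_diff[symmetric])
  finally show "norm x powr (- (1 + j)) / norm x = norm x powr (- (2 + j))" by simp
qed

text \<open>Off the plane |z|^i = z^2 rho <= B, and the power -1/i turns this into B^(-1/i) <=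
  1/|z|.\<close>

lemma V_bound:
  assumes x: "x \<in> ball 0 1"
  shows "\<bar>V x\<bar> \<le> 1"
proof (cases "x \<bullet> e = 0")
  case False
  then have x0: "x \<noteq> 0" by auto
  have z: "0 < \<bar>x \<bullet> e\<bar>" using False by simp
  have "\<bar>x \<bullet> e\<bar> powr i = (x \<bullet> e)\<^sup>2 * pw x"
  proof -
    have "\<bar>x \<bullet> e\<bar> powr i = \<bar>x \<bullet> e\<bar> powr (2 + - j)" by (simp add: i_def)
    also have "\<dots> = \<bar>x \<bullet> e\<bar> powr 2 * pw x" unfolding pw_def by (rule powr_add)
    finally show ?thesis using z by (simp add: powr_numeral)
  qed
  then have le: "\<bar>x \<bullet> e\<bar> powr i \<le> B x" using B_lower(2)[OF x] by simp
  have "B x powr (- (1 / i)) \<le> (\<bar>x \<bullet> e\<bar> powr i) powr (- (1 / i))"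
    using le z i by (intro powr_mono2') auto
  also have "\<dots> = \<bar>x \<bullet> e\<bar> powr (- 1)" using i by (simp add: powr_powr)
  also have "\<dots> = 1 / \<bar>x \<bullet> e\<bar>" using z by (simp add: powr_minus_divide)
  finally have "\<bar>x \<bullet> e\<bar> * B x powr (- (1 / i)) \<le> \<bar>x \<bullet> e\<bar> * (1 / \<bar>x \<bullet> e\<bar>)"
    by (rule mult_left_mono) simp
  then show ?thesis using z by (simp add: V_def abs_mult)
qed (simp add: V_def)

lemma grad_V_bound:
  assumes x: "x \<in> ball 0 1" "x \<bullet> e \<noteq> 0"
  shows "norm (grad_V x) \<le> (3 + A) * norm x powr (- (1 + j))"
proof -
  have x0: "x \<noteq> 0" using x by auto
  have A0: "0 \<le> A" using parameters_pos by simp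
  have R: "x \<bullet> x = (norm x)\<^sup>2" by (simp add: dot_square_norm)
  have ji: "0 \<le> j / i" "j / i \<le> 1" using i j j1 by auto
  have "norm (grad_V x) = B x powr (- \<beta>) * norm ((x \<bullet> x + j / i * A * (x \<bullet> e)\<^sup>2) *\<^sub>R e - (2 / i * (x \<bullet> e)) *\<^sub>R x)"
    by (simp add: grad_V_def)
  also have "\<dots> \<le> B x powr (- \<beta>) * (\<bar>x \<bullet> x + j / i * A * (x \<bullet> e)\<^sup>2\<bar> + \<bar>2 / i * (x \<bullet> e)\<bar> * norm x)"
    by (intro mult_left_mono norm_triangle_le_diff) auto
  also have "\<dots> \<le> B x powr (- \<beta>) * (((norm x)\<^sup>2 + 1 * A * (norm x)\<^sup>2) + 2 * (norm x)\<^sup>2)"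
  proof (intro mult_left_mono add_mono)
    have "j / i * A * (x \<bullet> e)\<^sup>2 \<le> 1 * A * (norm x)\<^sup>2"
      using ji A0 square_inner_e[of x] unfolding R by (intro mult_mono mult_right_mono) auto
    moreover have "0 \<le> j / i * A * (x \<bullet> e)\<^sup>2" using ji A0 by (intro mult_nonneg_nonneg) auto
    ultimately show "\<bar>x \<bullet> x + j / i * A * (x \<bullet> e)\<^sup>2\<bar> \<le> (norm x)\<^sup>2 + 1 * A * (norm x)\<^sup>2"
      unfolding R by simp
    have "\<bar>2 / i * (x \<bullet> e)\<bar> = 2 / i * \<bar>x \<bullet> e\<bar>" using i by (simp add: abs_mult)
    also have "\<dots> \<le> 2 * norm x"
      using i abs_inner_e[of x] by (intro mult_mono) (auto simp: divide_le_eq)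
    finally show "\<bar>2 / i * (x \<bullet> e)\<bar> * norm x \<le> 2 * (norm x)\<^sup>2"
      using mult_right_mono[of "\<bar>2 / i * (x \<bullet> e)\<bar>" "2 * norm x" "norm x"]
      by (simp add: power2_eq_square)
  qed simp
  also have "\<dots> = (3 + A) * (B x powr (- \<beta>) * (norm x)\<^sup>2)" by (simp add: algebra_simps)
  also have "\<dots> \<le> (3 + A) * norm x powr (- (1 + j))"
    using A0 by (intro mult_left_mono norm_powr_bound x x0) auto
  finally show ?thesis .
qed

lemma eta_bounds:
  assumes x: "x \<in> ball 0 1" "x \<bullet> e \<noteq> 0"
  shows "\<bar>\<eta> x\<bar> \<le> (y0 + 2 * y1) * norm x powr (- (1 + j))"
    and "norm (grad_\<eta> x) \<le> (y0 + 2 * y1) * (2 + \<beta> * (2 + 4 * A)) * (pw x * norm x powr (- (2 + j)))"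
proof -
  have x0: "x \<noteq> 0" using x by auto
  have p: "1 \<le> pw x" by (rule pw_ge_1[OF x])
  have B: "0 < B x" by (rule B_pos[OF x(1) x0])
  note pos = parameters_pos
  define Y where "Y = y0 + 2 * y1"
  have Y: "0 < Y" using pos by (simp add: Y_def)
  let ?P = "B x powr (- \<beta>)"
  have R: "x \<bullet> x = (norm x)\<^sup>2" by (simp add: dot_square_norm)
  have \<eta>: "\<bar>\<eta> x\<bar> \<le> Y * (?P * (norm x)\<^sup>2)"
  proof -
    have "\<bar>y1 * (x \<bullet> x) + (y0 - y1) * (x \<bullet> e)\<^sup>2\<bar> \<le> y1 * (norm x)\<^sup>2 + (y0 + y1) * (norm x)\<^sup>2"
    proof (intro order.trans[OF abs_triangle_ineq] add_mono)
      show "\<bar>y1 * (x \<bullet> x)\<bar> \<le> y1 * (norm x)\<^sup>2" using pos by (simp add: R abs_mult)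
      have "\<bar>(y0 - y1) * (x \<bullet> e)\<^sup>2\<bar> = \<bar>y0 - y1\<bar> * (x \<bullet> e)\<^sup>2" by (simp add: abs_mult)
      also have "\<dots> \<le> (y0 + y1) * (norm x)\<^sup>2"
        using square_inner_e[of x] pos unfolding R by (intro mult_mono) auto
      finally show "\<bar>(y0 - y1) * (x \<bullet> e)\<^sup>2\<bar> \<le> (y0 + y1) * (norm x)\<^sup>2" .
    qed
    also have "\<dots> = Y * (norm x)\<^sup>2" by (simp add: Y_def algebra_simps)
    finally have *: "\<bar>y1 * (x \<bullet> x) + (y0 - y1) * (x \<bullet> e)\<^sup>2\<bar> \<le> Y * (norm x)\<^sup>2" .
    have "\<bar>\<eta> x\<bar> = \<bar>y1 * (x \<bullet> x) + (y0 - y1) * (x \<bullet> e)\<^sup>2\<bar> / i * ?P"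
      using i by (simp add: \<eta>_def abs_mult)
    also have "\<dots> \<le> \<bar>y1 * (x \<bullet> x) + (y0 - y1) * (x \<bullet> e)\<^sup>2\<bar> / 1 * ?P"
      using i by (intro mult_right_mono divide_left_mono) auto
    also have "\<dots> \<le> Y * (norm x)\<^sup>2 * ?P"
      using * by (intro mult_right_mono) auto
    finally show ?thesis by (simp add: mult_ac)
  qed
  also have "\<dots> \<le> Y * norm x powr (- (1 + j))"
    using Y by (intro mult_left_mono norm_powr_bound x x0) auto
  finally show "\<bar>\<eta> x\<bar> \<le> (y0 + 2 * y1) * norm x powr (- (1 + j))" unfolding Y_def .
  have "norm (grad_\<eta> x) \<le> norm ((?P / i) *\<^sub>R ((2 * y1) *\<^sub>R x + (2 * (y0 - y1) * (x \<bullet> e)) *\<^sub>R e))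
      + \<beta> * \<bar>\<eta> x\<bar> / B x * norm (grad_B x)"
    unfolding grad_\<eta>_def using pos B by (intro norm_triangle_le_diff) (simp add: abs_mult)
  also have "\<dots> \<le> 2 * Y * (?P * norm x * pw x) + \<beta> * Y * (2 + 4 * A) * (?P * norm x * pw x)"
  proof (rule add_mono)
    have "norm ((2 * y1) *\<^sub>R x + (2 * (y0 - y1) * (x \<bullet> e)) *\<^sub>R e) \<le> 2 * y1 * norm x + 2 * (y0 + y1) * norm x"
    proof (intro norm_triangle_le add_mono)
      show "norm ((2 * y1) *\<^sub>R x) \<le> 2 * y1 * norm x" using pos by simp
      have "norm ((2 * (y0 - y1) * (x \<bullet> e)) *\<^sub>R e) = 2 * \<bar>y0 - y1\<bar> * \<bar>x \<bullet> e\<bar>"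
        by (simp only: norm_scaleR norm_e abs_mult abs_numeral mult_1_right)
      also have "\<dots> \<le> 2 * (y0 + y1) * norm x"
        using abs_inner_e[of x] pos by (intro mult_mono) auto
      finally show "norm ((2 * (y0 - y1) * (x \<bullet> e)) *\<^sub>R e) \<le> 2 * (y0 + y1) * norm x" .
    qed
    also have "\<dots> = 2 * Y * (norm x * 1)" by (simp add: Y_def algebra_simps)
    also have "\<dots> \<le> 2 * Y * (norm x * pw x)" using p Y by (intro mult_left_mono) auto
    finally have *: "norm ((2 * y1) *\<^sub>R x + (2 * (y0 - y1) * (x \<bullet> e)) *\<^sub>R e) \<le> 2 * Y * (norm x * pw x)" .
    have "norm ((?P / i) *\<^sub>R ((2 * y1) *\<^sub>R x + (2 * (y0 - y1) * (x \<bullet> e)) *\<^sub>R e))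
        = ?P / i * norm ((2 * y1) *\<^sub>R x + (2 * (y0 - y1) * (x \<bullet> e)) *\<^sub>R e)"
      using i by (simp add: abs_mult)
    also have "\<dots> \<le> ?P / 1 * (2 * Y * (norm x * pw x))"
      using i * by (intro mult_mono divide_left_mono) auto
    finally show "norm ((?P / i) *\<^sub>R ((2 * y1) *\<^sub>R x + (2 * (y0 - y1) * (x \<bullet> e)) *\<^sub>R e))
        \<le> 2 * Y * (?P * norm x * pw x)" by (simp add: mult_ac)
    have "\<bar>\<eta> x\<bar> / B x \<le> Y * (?P * (norm x)\<^sup>2) / B x"
      using \<eta> B by (intro divide_right_mono) auto
    also have "\<dots> = Y * ?P * ((norm x)\<^sup>2 / B x)" by simp
    also have "\<dots> \<le> Y * ?P * 1"
      using Y by (intro mult_left_mono divide_B_le x x0) auto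
    finally have "\<bar>\<eta> x\<bar> / B x \<le> Y * ?P" by simp
    then have "\<beta> * (\<bar>\<eta> x\<bar> / B x) * norm (grad_B x) \<le> \<beta> * (Y * ?P) * ((2 + 4 * A) * (norm x * pw x))"
      using pos B Y by (intro mult_mono norm_grad_B x mult_left_mono) auto
    then show "\<beta> * \<bar>\<eta> x\<bar> / B x * norm (grad_B x) \<le> \<beta> * Y * (2 + 4 * A) * (?P * norm x * pw x)"
      by (simp add: mult_ac)
  qed
  also have "\<dots> = Y * (2 + \<beta> * (2 + 4 * A)) * (pw x * (?P * (norm x)\<^sup>2 / norm x))"
    using x0 by (simp add: power2_eq_square algebra_simps)
  also have "\<dots> \<le> Y * (2 + \<beta> * (2 + 4 * A)) * (pw x * (norm x powr (- (1 + j)) / norm x))"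
    using Y pos p by (intro mult_left_mono divide_right_mono norm_powr_bound x x0) auto
  finally show "norm (grad_\<eta> x) \<le> (y0 + 2 * y1) * (2 + \<beta> * (2 + 4 * A)) * (pw x * norm x powr (- (2 + j)))"
    unfolding Y_def norm_powr_bound(3)[OF x(1) x0] .
qed

text \<open>A common majorant: s = 1 for the fields and for grad V, s = 2 for the gradients of
  \<open>\<kappa>\<close> and \<open>h\<close>. All integrability questions thus reduce to that of
  one explicit function.\<close>

definition weight where "weight s x = pw x * norm x powr (- (s + j))"

lemma weight_facts:
  assumes x: "x \<in> ball 0 1" "x \<bullet> e \<noteq> 0"
  shows "1 \<le> weight 1 x" "pw x / norm x \<le> weight 1 x" "norm x powr (- (1 + j)) \<le> weight 1 x"
    "pw x / (norm x)\<^sup>2 \<le> weight 2 x" "(pw x / norm x) * norm x powr (- (1 + j)) = weight 2 x"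
proof -
  have x0: "x \<noteq> 0" using x by auto
  have p: "1 \<le> pw x" by (rule pw_ge_1[OF x])
  note n = norm_powr_bound[OF x(1) x0]
  have r: "1 \<le> 1 / norm x" using x x0 by simp
  have "1 * (1 / norm x) \<le> pw x * norm x powr (- (1 + j))"
    using p n(1) by (intro mult_mono) auto
  with r show "1 \<le> weight 1 x" by (simp add: weight_def)
  have "pw x * (1 / norm x) \<le> pw x * norm x powr (- (1 + j))"
    using p n(1) by (intro mult_left_mono) auto
  then show "pw x / norm x \<le> weight 1 x" by (simp add: weight_def)
  have "1 * norm x powr (- (1 + j)) \<le> pw x * norm x powr (- (1 + j))"
    using p by (intro mult_right_mono) auto
  then show "norm x powr (- (1 + j)) \<le> weight 1 x" by (simp add: weight_def)
  have "pw x * ((1 / norm x) / norm x) \<le> pw x * (norm x powr (- (1 + j)) / norm x)"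
    using p n(1) by (intro mult_left_mono divide_right_mono) auto
  then show "pw x / (norm x)\<^sup>2 \<le> weight 2 x"
    unfolding n(3) weight_def by (simp add: power2_eq_square)
  show "(pw x / norm x) * norm x powr (- (1 + j)) = weight 2 x"
    unfolding weight_def n(3)[symmetric] by simp
qed

lemma field_bounds:
  obtains C where "0 \<le> C"
    "\<And>x. x \<in> ball 0 1 \<Longrightarrow> x \<bullet> e \<noteq> 0 \<Longrightarrow> norm (u x) \<le> C * weight 1 x"
    "\<And>x. x \<in> ball 0 1 \<Longrightarrow> x \<bullet> e \<noteq> 0 \<Longrightarrow> norm (\<kappa> x) \<le> C * weight 1 x"
    "\<And>x. x \<in> ball 0 1 \<Longrightarrow> x \<bullet> e \<noteq> 0 \<Longrightarrow> norm (grad_V x) \<le> C * weight 1 x"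
    "\<And>x. x \<in> ball 0 1 \<Longrightarrow> x \<bullet> e \<noteq> 0 \<Longrightarrow> norm (h x) \<le> C * weight 1 x"
    "\<And>x. x \<in> ball 0 1 \<Longrightarrow> x \<bullet> e \<noteq> 0 \<Longrightarrow> norm (grad_\<kappa> x) \<le> C * weight 2 x"
    "\<And>x. x \<in> ball 0 1 \<Longrightarrow> x \<bullet> e \<noteq> 0 \<Longrightarrow> norm (grad_h x) \<le> C * weight 2 x"
proof -
  define a where "a = \<beta> * c * (3 + 4 * A)"
  define b where "b = 3 + A"
  define Y where "Y = y0 + 2 * y1"
  define d where "d = Y * (2 + \<beta> * (2 + 4 * A))"
  have pos: "0 < a" "0 < b" "0 < Y" "0 < d"
    using parameters_pos c_pos by (auto simp: a_def b_def Y_def d_def intro!: mult_pos_pos add_pos_pos)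
  have M0: "2 \<le> M" by (rule M)
  define C where "C = (M + 2) * a + b + a * b + a + Y + d"
  have aM: "a \<le> (M + 2) * a" using pos M0 by simp
  have ab: "0 < a * b" using pos by simp
  have C: "(M + 2) * a \<le> C" "a \<le> C" "b \<le> C" "a + Y \<le> C" "a * b + a + d \<le> C" "0 \<le> C"
    using aM ab pos unfolding C_def by linarith+
  show thesis
  proof (rule that[of C])
    fix x assume x: "x \<in> ball 0 1" "x \<bullet> e \<noteq> 0"
    note w = weight_facts[OF x]
    have p: "1 \<le> pw x" by (rule pw_ge_1[OF x])
    have x0: "x \<noteq> 0" using x by auto
    have w2: "0 \<le> weight 2 x" using p by (simp add: weight_def)
    have lift: "N \<le> C * W" if "N \<le> t * s" "s \<le> W" "0 \<le> t" "t \<le> C" "0 \<le> W" for N s t W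
    proof -
      have "t * s \<le> t * W" using that by (intro mult_left_mono) auto
      also have "\<dots> \<le> C * W" using that by (intro mult_right_mono) auto
      finally show ?thesis using that by simp
    qed
    note k = kappa_bounds[OF x, folded a_def]
    note gV = grad_V_bound[OF x, folded b_def]
    note et = eta_bounds[OF x, folded Y_def, folded d_def]
    have w1: "0 \<le> weight 1 x" using w(1) by simp
    show "norm (u x) \<le> C * weight 1 x"
      by (rule lift[OF u_bound[OF x, folded a_def] w(2) _ C(1) w1]) (use pos M0 in simp)
    show "norm (\<kappa> x) \<le> C * weight 1 x"
      unfolding real_norm_def by (rule lift[OF k(1) w(2) _ C(2) w1]) (use pos in simp)
    show "norm (grad_V x) \<le> C * weight 1 x"
      by (rule lift[OF gV w(3) _ C(3) w1]) (use pos in simp)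
    show "norm (grad_\<kappa> x) \<le> C * weight 2 x"
      by (rule lift[OF k(2) w(4) _ C(2) w2]) (use pos in simp)
    have "norm (h x) \<le> \<bar>\<kappa> x\<bar> * \<bar>V x\<bar> + \<bar>\<eta> x\<bar>"
      unfolding h_def by (simp add: abs_mult[symmetric])
    also have "\<dots> \<le> (a * (pw x / norm x)) * 1 + Y * norm x powr (- (1 + j))"
      using k(1) et(1) V_bound[OF x(1)] pos p by (intro add_mono mult_mono) auto
    also have "\<dots> \<le> a * weight 1 x + Y * weight 1 x"
      using w(2,3) pos unfolding mult_1_right by (intro add_mono mult_left_mono) auto
    finally have "norm (h x) \<le> (a + Y) * weight 1 x" by (simp add: distrib_right)
    then show "norm (h x) \<le> C * weight 1 x"
      by (rule lift[OF _ order.refl _ C(4) w1]) (use pos in simp)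
    have "norm (grad_h x) \<le> \<bar>\<kappa> x\<bar> * norm (grad_V x) + \<bar>V x\<bar> * norm (grad_\<kappa> x) + norm (grad_\<eta> x)"
      unfolding grad_h_def by (intro norm_triangle_le_diff add_mono norm_triangle_le) auto
    also have "\<dots> \<le> (a * (pw x / norm x)) * (b * norm x powr (- (1 + j))) + 1 * (a * (pw x / (norm x)\<^sup>2))
        + d * (pw x * norm x powr (- (2 + j)))"
      using k et(2) gV V_bound[OF x(1)] pos p by (intro add_mono mult_mono) auto
    also have "(a * (pw x / norm x)) * (b * norm x powr (- (1 + j)))
        = a * b * ((pw x / norm x) * norm x powr (- (1 + j)))" by (simp only: mult_ac)
    also have "\<dots> = a * b * weight 2 x" unfolding w(5) ..
    also have "d * (pw x * norm x powr (- (2 + j))) = d * weight 2 x" by (simp add: weight_def)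
    also have "a * b * weight 2 x + 1 * (a * (pw x / (norm x)\<^sup>2)) + d * weight 2 x
        \<le> a * b * weight 2 x + 1 * (a * weight 2 x) + d * weight 2 x"
      using w(4) pos by (intro add_mono mult_left_mono) auto
    finally have "norm (grad_h x) \<le> (a * b + a + d) * weight 2 x" by (simp add: distrib_right)
    then show "norm (grad_h x) \<le> C * weight 2 x"
      by (rule lift[OF _ order.refl _ C(5) w2]) (use pos ab in simp)
  qed (rule C)
qed

subsection \<open>Weak formulation\<close>

lemma AE_off_plane: "AE x in lborel. x \<bullet> e \<noteq> 0"
  using e by (rule AE_lborel_inner_Basis_ne)

lemma integrable_weight_powr:
  assumes "1 \<le> q" "q * (j + (s + j) / DIM('a)) < 1" "0 \<le> s"
  shows "set_integrable lborel (ball 0 1) (\<lambda>x. weight s x powr q)"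
proof -
  have "weight s x powr q = \<bar>x \<bullet> e\<bar> powr (- (q * j)) * norm x powr (- (q * (s + j)))" for x
    unfolding weight_def pw_def by (subst powr_mult) (simp_all only: powr_ge_zero powr_powr mult.commute[of _ q] mult_minus_right)
  then show ?thesis
    using set_integrable_coordinate_norm_powr[OF e, of "q * (s + j)" "q * j"] assms j
    by (simp add: distrib_left)
qed

lemma weight_integrable:
  assumes "s \<le> 2" "0 \<le> s"
  shows "set_integrable lborel (ball 0 1) (weight s)"
proof -
  \<comment> \<open>Multiplied by n, the integrability condition reads j (n + 1) + s < n; at s = 2
    it is the locale assumption on \<open>j\<close>.\<close>
  have "(j + (s + j) / DIM('a)) * DIM('a) = j * (real DIM('a) + 1) + s"
    by (simp add: field_simps)
  also have "\<dots> < 1 * real DIM('a)" using j assms by simp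
  finally have "j + (s + j) / DIM('a) < 1"
    by (rule mult_right_less_imp_less) simp
  then have "set_integrable lborel (ball 0 1) (\<lambda>x. weight s x powr 1)"
    using assms by (intro integrable_weight_powr) auto
  moreover have "weight s x powr 1 = weight s x" for x
    by (simp add: weight_def pw_def)
  ultimately show ?thesis by simp
qed

lemma set_integrable_weight_bound:
  fixes f :: "'a \<Rightarrow> 'b::euclidean_space"
  assumes [measurable]: "f \<in> borel_measurable borel" and s: "s \<le> 2" "0 \<le> s"
    and bound: "\<And>x. x \<in> ball 0 1 \<Longrightarrow> x \<bullet> e \<noteq> 0 \<Longrightarrow> norm (f x) \<le> C * weight s x"
  shows "set_integrable lborel (ball 0 1) f"
  unfolding set_integrable_def
proof (rule Bochner_Integration.integrable_bound)
  show "integrable lborel (\<lambda>x. C * (indicator (ball 0 1) x * weight s x))"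
    using weight_integrable[OF s] by (simp add: set_integrable_def)
  show "AE x in lborel. norm (indicator (ball 0 1) x *\<^sub>R f x) \<le> norm (C * (indicator (ball 0 1) x * weight s x))"
    using AE_off_plane
  proof eventually_elim
    case (elim x)
    show ?case
    proof (cases "x \<in> ball 0 1")
      case True
      then show ?thesis using bound[OF True elim] by simp
    qed simp
  qed
  show "(\<lambda>x. indicator (ball 0 1) x *\<^sub>R f x) \<in> borel_measurable lborel"
    using assms(1) by (intro borel_measurable_scaleR borel_measurable_indicator) auto
qed

lemma fields_integrable:
  "set_integrable lborel (ball 0 1) u" "set_integrable lborel (ball 0 1) \<kappa>"
  "set_integrable lborel (ball 0 1) V" "set_integrable lborel (ball 0 1) grad_V"
  "set_integrable lborel (ball 0 1) h"
  "set_integrable lborel (ball 0 1) grad_\<kappa>" "set_integrable lborel (ball 0 1) grad_h"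
proof -
  obtain C where C: "0 \<le> C"
    "\<And>x. x \<in> ball 0 1 \<Longrightarrow> x \<bullet> e \<noteq> 0 \<Longrightarrow> norm (u x) \<le> C * weight 1 x"
    "\<And>x. x \<in> ball 0 1 \<Longrightarrow> x \<bullet> e \<noteq> 0 \<Longrightarrow> norm (\<kappa> x) \<le> C * weight 1 x"
    "\<And>x. x \<in> ball 0 1 \<Longrightarrow> x \<bullet> e \<noteq> 0 \<Longrightarrow> norm (grad_V x) \<le> C * weight 1 x"
    "\<And>x. x \<in> ball 0 1 \<Longrightarrow> x \<bullet> e \<noteq> 0 \<Longrightarrow> norm (h x) \<le> C * weight 1 x"
    "\<And>x. x \<in> ball 0 1 \<Longrightarrow> x \<bullet> e \<noteq> 0 \<Longrightarrow> norm (grad_\<kappa> x) \<le> C * weight 2 x"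
    "\<And>x. x \<in> ball 0 1 \<Longrightarrow> x \<bullet> e \<noteq> 0 \<Longrightarrow> norm (grad_h x) \<le> C * weight 2 x"
    using field_bounds by blast
  show "set_integrable lborel (ball 0 1) u"
    by (rule set_integrable_weight_bound[OF _ _ _ C(2)]) auto
  show "set_integrable lborel (ball 0 1) \<kappa>"
    by (rule set_integrable_weight_bound[OF _ _ _ C(3)]) auto
  show "set_integrable lborel (ball 0 1) grad_V"
    by (rule set_integrable_weight_bound[OF _ _ _ C(4)]) auto
  show "set_integrable lborel (ball 0 1) h"
    by (rule set_integrable_weight_bound[OF _ _ _ C(5)]) auto
  show "set_integrable lborel (ball 0 1) grad_\<kappa>"
    by (rule set_integrable_weight_bound[OF _ _ _ C(6)]) auto
  show "set_integrable lborel (ball 0 1) grad_h"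
    by (rule set_integrable_weight_bound[OF _ _ _ C(7)]) auto
  show "set_integrable lborel (ball 0 1) V"
  proof (rule set_integrable_weight_bound)
    show "norm (V x) \<le> 1 * weight 1 x" if "x \<in> ball 0 1" "x \<bullet> e \<noteq> 0" for x
      using V_bound[OF that(1)] weight_facts(1)[OF that] by simp
  qed auto
qed

text \<open>By \<open>V_u\<close>, V u is a stream field plus grad V. The stream field integrates to
  0 against grad \<phi>, and grad V cancels the Laplacian term after one integration by
  parts.\<close>

lemma
  assumes K: "compact K" "K \<subseteq> ball 0 1"
    and \<phi>: "C_k 2 \<phi>" "\<And>x. x \<notin> K \<Longrightarrow> \<phi> x = 0"
  shows integrable_u_grad: "integrable lborel (\<lambda>x. u x \<bullet> grad \<phi> x)"
    and integral_u_grad: "(\<integral>x. u x \<bullet> grad \<phi> x \<partial>lborel) = 0"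
    and integral_V_equation: "(\<integral>x. V x * (laplacian \<phi> x + u x \<bullet> grad \<phi> x) \<partial>lborel) = 0"
proof -
  have dim2: "2 \<le> DIM('a)" using dim by simp
  have Km: "K \<in> sets borel" by (intro borel_closed compact_imp_closed K)
  have sub: "set_integrable lborel K f" if "set_integrable lborel (ball 0 1) f" for f :: "'a \<Rightarrow> 'b::euclidean_space"
    by (rule set_integrable_subset[OF that _ K(2)]) (simp add: Km)
  have sets: "set_integrable lborel K u" "set_integrable lborel K \<kappa>" "set_integrable lborel K V"
    "set_integrable lborel K grad_V" "set_integrable lborel K h"
    "set_integrable lborel K grad_\<kappa>" "set_integrable lborel K grad_h"
    by (rule sub, rule fields_integrable)+
  note \<kappa> = sets(2,6) isCont_fields(2) GDERIV_fields(2)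
  note h = sets(5,7) isCont_fields(3) GDERIV_fields(3)
  note V = sets(3,4) isCont_fields(1) GDERIV_fields(1)
  note D = e dim2 K open_ball \<phi>
  show "integrable lborel (\<lambda>x. u x \<bullet> grad \<phi> x)"
    unfolding u_def by (rule integrable_stream_field[OF D \<kappa>])
  show "(\<integral>x. u x \<bullet> grad \<phi> x \<partial>lborel) = 0"
    unfolding u_def by (rule integral_stream_field[OF D \<kappa>])
  note h = integral_stream_field[OF D h] integrable_stream_field[OF D h]
  note V = integral_laplacian[OF D V] integrable_laplacian[OF D V] integrable_grad_grad[OF D V]
  let ?f = "\<lambda>x. V x * (laplacian \<phi> x + u x \<bullet> grad \<phi> x)"
  let ?g = "\<lambda>x. V x * laplacian \<phi> x + stream_field e h grad_h x \<bullet> grad \<phi> x + grad_V x \<bullet> grad \<phi> x"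
  have gi: "integrable lborel ?g" using h V by simp
  have cK: "closed K" using K compact_imp_closed by blast
  have S: "C1_support K (partial b \<phi>)" if "b \<in> Basis" for b
    using C1_support_partial[OF \<phi>(1) cK \<phi>(2) that] by blast
  have "partial b \<phi> \<in> borel_measurable borel" "partial b (partial b \<phi>) \<in> borel_measurable borel"
    if "b \<in> Basis" for b
    using S[OF that] that C1_support_continuous_on[OF S[OF that]]
    by (simp_all add: C1_support_def borel_measurable_continuous_onI)
  then have "(\<lambda>x. laplacian \<phi> x) \<in> borel_measurable borel" "(\<lambda>x. grad \<phi> x) \<in> borel_measurable borel"
    unfolding laplacian_def grad_def
    by (intro borel_measurable_sum borel_measurable_scaleR borel_measurable_const; simp)+
  then have [measurable]: "?f \<in> borel_measurable lborel"
    by simp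
  have [measurable]: "?g \<in> borel_measurable lborel"
    using gi by (rule borel_measurable_integrable)
  \<comment> \<open>\<open>V_u\<close> is available only in the ball and off the null set z = 0;
    outside \<open>K\<close> both sides vanish with the derivatives of \<phi>.\<close>
  have eq: "AE x in lborel. ?g x = ?f x"
    using AE_off_plane
  proof eventually_elim
    case (elim x)
    show ?case
    proof (cases "x \<in> K")
      case True
      have "V x * (u x \<bullet> grad \<phi> x) = (V x *\<^sub>R u x) \<bullet> grad \<phi> x" by simp
      also have "\<dots> = (stream_field e h grad_h x + grad_V x) \<bullet> grad \<phi> x"
        using True K elim by (subst V_u) auto
      finally show ?thesis by (simp add: distrib_left inner_add_left)
    next
      case False
      have "b \<in> Basis \<Longrightarrow> partial b \<phi> x = 0" "b \<in> Basis \<Longrightarrow> partial b (partial b \<phi>) x = 0" for b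
        using S[of b] False partial_eq_0_outside(2)[OF cK _ False, of "partial b \<phi>"]
        by (auto simp: C1_support_def)
      then show ?thesis by (simp add: laplacian_def grad_def)
    qed
  qed
  have "(\<integral>x. ?f x \<partial>lborel) = (\<integral>x. ?g x \<partial>lborel)"
    by (rule integral_cong_AE) (use eq in auto)
  also have "\<dots> = 0" using h V by simp
  finally show "(\<integral>x. ?f x \<partial>lborel) = 0" .
qed

section \<open>Integrability exponents, divergence-freeness and the weak equation\<close>

lemma in_Lp_weight:
  fixes f :: "'a \<Rightarrow> 'b::euclidean_space"
  assumes f: "f \<in> borel_measurable borel" and q: "1 \<le> q" "q * (j + (1 + j) / DIM('a)) < 1"
    and C: "0 \<le> C" and bound: "\<And>x. x \<in> ball 0 1 \<Longrightarrow> x \<bullet> e \<noteq> 0 \<Longrightarrow> norm (f x) \<le> C * weight 1 x"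
  shows "in_Lp q (ball 0 1) f"
  unfolding in_Lp_def
proof
  show "set_borel_measurable lebesgue (ball 0 1) f"
    using f by (rule set_borel_measurable_lebesgue) simp
  have "set_integrable lborel (ball 0 1) (\<lambda>x. norm (f x) powr q)"
    unfolding set_integrable_def
  proof (rule Bochner_Integration.integrable_bound)
    show "integrable lborel (\<lambda>x. C powr q * (indicator (ball 0 1) x * weight 1 x powr q))"
      using integrable_weight_powr[OF q] by (simp add: set_integrable_def)
    show "(\<lambda>x. indicator (ball 0 1) x *\<^sub>R norm (f x) powr q) \<in> borel_measurable lborel"
    proof (intro borel_measurable_scaleR borel_measurable_indicator)
      have [measurable]: "f \<in> borel_measurable lborel" using f by simp
      show "(\<lambda>x. norm (f x) powr q) \<in> borel_measurable lborel" by measurable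
    qed simp
    show "AE x in lborel. norm (indicator (ball 0 1) x *\<^sub>R norm (f x) powr q)
        \<le> norm (C powr q * (indicator (ball 0 1) x * weight 1 x powr q))"
      using AE_off_plane
    proof eventually_elim
      case (elim x)
      show ?case
      proof (cases "x \<in> ball 0 1")
        case True
        have "norm (f x) powr q \<le> (C * weight 1 x) powr q"
          using bound[OF True elim] q by (intro powr_mono2) auto
        also have "\<dots> = C powr q * weight 1 x powr q"
          by (rule powr_mult)
        finally show ?thesis using True by simp
      qed simp
    qed
  qed
  then show "set_integrable lebesgue (ball 0 1) (\<lambda>x. norm (f x) powr q)"
    by (rule set_integrable_lebesgueI)
qed

lemma in_Lp_fields:
  assumes q: "1 \<le> q" "q * (j + (1 + j) / DIM('a)) < 1"
  shows "in_Lp q (ball 0 1) u" "in_Lp q (ball 0 1) V" "in_Lp q (ball 0 1) grad_V"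
proof -
  obtain C where C: "0 \<le> C"
    "\<And>x. x \<in> ball 0 1 \<Longrightarrow> x \<bullet> e \<noteq> 0 \<Longrightarrow> norm (u x) \<le> C * weight 1 x"
    "\<And>x. x \<in> ball 0 1 \<Longrightarrow> x \<bullet> e \<noteq> 0 \<Longrightarrow> norm (grad_V x) \<le> C * weight 1 x"
    using field_bounds by metis
  show "in_Lp q (ball 0 1) u" by (rule in_Lp_weight[OF _ q C(1,2)]) auto
  show "in_Lp q (ball 0 1) grad_V" by (rule in_Lp_weight[OF _ q C(1,3)]) auto
  show "in_Lp q (ball 0 1) V"
  proof (rule in_Lp_weight[OF _ q])
    show "norm (V x) \<le> 1 * weight 1 x" if "x \<in> ball 0 1" "x \<bullet> e \<noteq> 0" for x
      using V_bound[OF that(1)] weight_facts(1)[OF that] by simp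
  qed auto
qed

lemma integrable_V_u: "set_integrable lborel (ball 0 1) (\<lambda>x. V x *\<^sub>R u x)"
proof -
  obtain C where C: "0 \<le> C"
    "\<And>x. x \<in> ball 0 1 \<Longrightarrow> x \<bullet> e \<noteq> 0 \<Longrightarrow> norm (u x) \<le> C * weight 1 x"
    using field_bounds by metis
  show ?thesis
  proof (rule set_integrable_weight_bound)
    fix x assume x: "x \<in> ball 0 1" "x \<bullet> e \<noteq> 0"
    have "\<bar>V x\<bar> * norm (u x) \<le> 1 * norm (u x)"
      by (rule mult_right_mono[OF V_bound[OF x(1)]]) simp
    then show "norm (V x *\<^sub>R u x) \<le> C * weight 1 x" using C(2)[OF x] by simp
  qed auto
qed

lemma divergence_free_u: "divergence_free (ball 0 1) u"
  unfolding divergence_free_def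
proof (intro conjI allI impI)
  show "locally_integrable (ball 0 1) u" by (rule locally_integrableI[OF fields_integrable(1)])
  fix \<phi> :: "'a \<Rightarrow> real"
  assume "test_function (ball 0 1) \<phi>"
  then obtain K where K: "compact K" "K \<subseteq> ball 0 1" "C1_support K \<phi>" "C_k 2 \<phi>"
    by (rule test_function_support)
  have \<phi>0: "\<phi> x = 0" if "x \<notin> K" for x using K(3) that by (simp add: C1_support_def)
  have g0: "grad \<phi> x = 0" if "x \<notin> ball 0 1" for x
  proof -
    have "x \<notin> K" using that K by blast
    from partial_eq_0_outside(2)[OF compact_imp_closed[OF K(1)] \<phi>0 this]
    show ?thesis by (simp add: grad_def)
  qed
  have "integrable lborel (\<lambda>x. u x \<bullet> grad \<phi> x)"
    by (rule integrable_u_grad[OF K(1,2,4) \<phi>0])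
  then have "(LINT x:ball 0 1|lebesgue. u x \<bullet> grad \<phi> x) = (\<integral>x. u x \<bullet> grad \<phi> x \<partial>lborel)"
    by (rule set_integral_lebesgue_support) (use g0 in simp)
  also have "\<dots> = 0" by (rule integral_u_grad[OF K(1,2,4) \<phi>0])
  finally show "(LINT x:ball 0 1|lebesgue. u x \<bullet> grad \<phi> x) = 0" .
qed

lemma weak_gradient_V: "weak_gradient (ball 0 1) V grad_V"
  unfolding weak_gradient_def
proof (intro conjI allI impI ballI)
  show "locally_integrable (ball 0 1) V" "locally_integrable (ball 0 1) grad_V"
    by (rule locally_integrableI, rule fields_integrable)+
  fix \<phi> :: "'a \<Rightarrow> real" and b :: 'a
  assume "test_function (ball 0 1) \<phi>" and b: "b \<in> Basis"
  then obtain K where K: "compact K" "K \<subseteq> ball 0 1" "C1_support K \<phi>"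
    by (auto elim: test_function_support)
  have Km: "K \<in> sets lborel" using K(1) by (simp add: borel_closed compact_imp_closed)
  have \<phi>0: "\<phi> x = 0" if "x \<notin> K" for x using K(3) that by (simp add: C1_support_def)
  have p0: "partial b \<phi> x = 0" if "x \<notin> K" for x
    by (rule partial_eq_0_outside(2)[OF compact_imp_closed[OF K(1)] _ that]) (rule \<phi>0)
  have 0: "V x * partial b \<phi> x = 0" "(grad_V x \<bullet> b) * \<phi> x = 0" if "x \<notin> ball 0 1" for x
  proof -
    have "x \<notin> K" using K(2) that by blast
    then show "V x * partial b \<phi> x = 0" "(grad_V x \<bullet> b) * \<phi> x = 0" by (simp_all add: \<phi>0 p0)
  qed
  have dim2: "2 \<le> DIM('a)" using dim by simp
  have V: "set_integrable lborel K V" "set_integrable lborel K grad_V"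
    by (rule set_integrable_subset[OF _ Km K(2)], rule fields_integrable)+
  note D = e b dim2 K(1,2) open_ball K(3) V isCont_fields(1) GDERIV_fields(1)
  have "(LINT x:ball 0 1|lebesgue. V x * partial b \<phi> x) = (\<integral>x. V x * partial b \<phi> x \<partial>lborel)"
    by (rule set_integral_lebesgue_support[OF integrable_mult_partial[OF D] 0(1)])
  also have "\<dots> = - (\<integral>x. (grad_V x \<bullet> b) * \<phi> x \<partial>lborel)"
    by (rule integral_by_parts_partial[OF D])
  also have "(\<integral>x. (grad_V x \<bullet> b) * \<phi> x \<partial>lborel) = (LINT x:ball 0 1|lebesgue. (grad_V x \<bullet> b) * \<phi> x)"
    by (rule set_integral_lebesgue_support[OF integrable_grad_mult[OF D] 0(2), symmetric])
  finally show "(LINT x:ball 0 1|lebesgue. V x * partial b \<phi> x) = - (LINT x:ball 0 1|lebesgue. (grad_V x \<bullet> b) * \<phi> x)" .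
qed

text \<open>The time derivative and the spatial operator are integrated separately: the first
  vanishes by translation in time, V being stationary, the second on every time slice by
  \<open>integral_V_equation\<close>.\<close>

lemma weak_equation:
  assumes \<phi>: "test_function (ball (0::'a) 1 \<times> {0<..<1::real}) \<phi>"
  shows "(LINT (x, t):ball 0 1 \<times> {0<..<1}|lebesgue.
    V x * (deriv (\<lambda>s. \<phi> (x, s)) t + laplacian (\<lambda>y. \<phi> (y, t)) x + u x \<bullet> grad (\<lambda>y. \<phi> (y, t)) x)) = 0"
proof -
  obtain K where K: "compact K" "K \<subseteq> ball 0 1 \<times> {0<..<1}" "C1_support K \<phi>"
    "\<And>b. b \<in> Basis \<Longrightarrow> C1_support K (partial b \<phi>)" "C_k 2 \<phi>"
    using \<phi> by (rule test_function_support) blast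
  have cK: "closed K" using K(1) by (rule compact_imp_closed)
  have Km: "K \<in> sets lborel" using cK by simp
  have \<phi>0: "\<phi> y = 0" if "y \<notin> K" for y using K(3) that unfolding C1_support_def by blast
  have dif: "\<phi> differentiable (at y)" for y using K(3) unfolding C1_support_def by blast
  have difp: "partial b \<phi> differentiable (at y)" if "b \<in> Basis" for b y
    using K(4)[OF that] unfolding C1_support_def by blast
  let ?T = "(0::'a, 1::real)"
  have T: "?T \<in> Basis" by (simp add: Basis_prod_def)
  have deriv: "deriv (\<lambda>s. \<phi> (x, s)) t = partial ?T \<phi> (x, t)"
    and der: "((\<lambda>s. \<phi> (x, s)) has_real_derivative partial ?T \<phi> (x, t)) (at t)" for x t
  proof -
    have "GDERIV \<phi> ((x, 0) + t *\<^sub>R ?T) :> grad \<phi> (x, t)" using GDERIV_grad[OF dif] by simp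
    from GDERIV_has_real_derivative_line[OF this]
    show der: "((\<lambda>s. \<phi> (x, s)) has_real_derivative partial ?T \<phi> (x, t)) (at t)"
      using grad_inner_Basis[OF T, of \<phi> "(x, t)"] by (simp add: inner_commute)
    then show "deriv (\<lambda>s. \<phi> (x, s)) t = partial ?T \<phi> (x, t)" by (rule DERIV_imp_deriv)
  qed
  have p: "partial b (\<lambda>y. \<phi> (y, t)) = (\<lambda>x. partial (b, 0) \<phi> (x, t))" for b t
    using partial_slice(2)[OF dif] by (simp add: fun_eq_iff)
  have pp: "partial b (partial b (\<lambda>y. \<phi> (y, t))) x = partial (b, 0) (partial (b, 0) \<phi>) (x, t)" if "b \<in> Basis" for b t x
    unfolding p using partial_slice(2)[OF difp[OF Basis_pair_left[OF that]]] by simp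
  define F1 where "F1 y = V (fst y) * partial ?T \<phi> y" for y
  define F2 where "F2 y = V (fst y) * (laplacian (\<lambda>x. \<phi> (x, snd y)) (fst y) + u (fst y) \<bullet> grad (\<lambda>x. \<phi> (x, snd y)) (fst y))" for y
  \<comment> \<open>In terms of space-time partial derivatives of \<phi>, which are jointly
    continuous, integrability of \<open>F2\<close> on the product is visible; Fubini needs it before
    slicing.\<close>
  have F2_eq: "F2 y = (\<Sum>b\<in>Basis. V (fst y) * partial (b, 0) (partial (b, 0) \<phi>) y)
      + (\<Sum>b\<in>Basis. ((V (fst y) *\<^sub>R u (fst y)) \<bullet> b) * partial (b, 0) \<phi> y)" for y
    by (simp add: F2_def laplacian_def grad_def pp[unfolded p] p inner_sum_right distrib_left sum_distrib_left mult_ac)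
  have cyl: "set_integrable lborel K (\<lambda>y. f (fst y))" if "set_integrable lborel (ball 0 1) f" for f :: "'a \<Rightarrow> 'b::euclidean_space"
  proof -
    have "set_integrable lborel (ball 0 1 \<times> {0<..<1}) (\<lambda>(x, t::real). f x)"
      by (rule set_integrable_fst_cylinder[OF that])
    from set_integrable_subset[OF this Km K(2)] show ?thesis by (simp add: split_beta')
  qed
  have iV: "set_integrable lborel K (\<lambda>y. V (fst y))" by (rule cyl[OF fields_integrable(3)])
  have iVu: "set_integrable lborel K (\<lambda>y. (V (fst y) *\<^sub>R u (fst y)) \<bullet> b)" for b
    using integrable_inner_left[OF cyl[OF integrable_V_u, unfolded set_integrable_def], of b]
    by (simp add: set_integrable_def mult.assoc)
  have supp: "continuous_on UNIV f \<and> (\<forall>y. y \<notin> K \<longrightarrow> f y = 0)" if "C1_support K f" for f :: "'a \<times> real \<Rightarrow> real"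
    using C1_support_continuous_on[OF that] that by (simp add: C1_support_def)
  have supp2: "continuous_on UNIV (partial b (partial b \<phi>)) \<and> (\<forall>y. y \<notin> K \<longrightarrow> partial b (partial b \<phi>) y = 0)"
    if b: "b \<in> Basis" for b
  proof (intro conjI allI impI)
    show "continuous_on UNIV (partial b (partial b \<phi>))" using K(4)[OF b] b by (simp add: C1_support_def)
    show "partial b (partial b \<phi>) y = 0" if "y \<notin> K" for y
      by (rule partial_eq_0_outside(2)[OF cK _ that]) (use supp[OF K(4)[OF b]] in blast)
  qed
  have iF1: "integrable lborel F1"
    unfolding F1_def using supp[OF K(4)[OF T]] by (intro integrable_mult_support[OF _ _ K(1) iV]) auto
  have iF2: "integrable lborel F2"
    unfolding F2_eq[abs_def]
  proof (intro Bochner_Integration.integrable_add Bochner_Integration.integrable_sum)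
    fix b :: 'a assume b: "b \<in> Basis"
    note b' = Basis_pair_left[OF b, where 'b = real]
    show "integrable lborel (\<lambda>y. V (fst y) * partial (b, 0) (partial (b, 0) \<phi>) y)"
      using supp2[OF b'] by (intro integrable_mult_support[OF _ _ K(1) iV]) auto
    show "integrable lborel (\<lambda>y. ((V (fst y) *\<^sub>R u (fst y)) \<bullet> b) * partial (b, 0) \<phi> y)"
      using supp[OF K(4)[OF b']] by (intro integrable_mult_support[OF _ _ K(1) iVu]) auto
  qed
  have 1: "(\<integral>y. F1 y \<partial>lborel) = 0"
  proof (rule integral_directional_derivative_eq_0[OF _ iF1])
    show "integrable lborel (\<lambda>y. V (fst y) * \<phi> y)"
      using supp[OF K(3)] by (intro integrable_mult_support[OF _ _ K(1) iV]) auto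
    \<comment> \<open>Along time lines V is constant, so the product is differentiable on every line
      and the exceptional set is empty.\<close>
    have d: "((\<lambda>s. V (fst (y + s *\<^sub>R ?T)) * \<phi> (y + s *\<^sub>R ?T)) has_real_derivative F1 (y + t *\<^sub>R ?T)) (at t)" for y t
    proof -
      have "((\<lambda>s. \<phi> (fst y, s + snd y)) has_real_derivative partial ?T \<phi> (fst y, t + snd y)) (at t)"
        using DERIV_shift[of "\<lambda>s. \<phi> (fst y, s)" "partial ?T \<phi> (fst y, t + snd y)" t "snd y"] der by simp
      then show ?thesis
        by (cases y) (auto simp: F1_def add.commute intro!: derivative_eq_intros)
    qed
    show "AE y in lborel. continuous_on {0..1} (\<lambda>s. V (fst (y + s *\<^sub>R ?T)) * \<phi> (y + s *\<^sub>R ?T)) \<and>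
       (\<exists>S. finite S \<and> (\<forall>t\<in>{0<..<1} - S. ((\<lambda>s. V (fst (y + s *\<^sub>R ?T)) * \<phi> (y + s *\<^sub>R ?T))
          has_real_derivative F1 (y + t *\<^sub>R ?T)) (at t)))"
    proof (intro AE_I2 conjI exI[of _ "{}"])
      show "continuous_on {0..1} (\<lambda>s. V (fst (y + s *\<^sub>R ?T)) * \<phi> (y + s *\<^sub>R ?T))" for y
        by (intro continuous_at_imp_continuous_on ballI DERIV_isCont[OF d])
    qed (use d in auto)
  qed
  have 2: "(\<integral>y. F2 y \<partial>lborel) = 0"
  proof -
    have i: "integrable (lborel \<Otimes>\<^sub>M lborel) (case_prod (\<lambda>x t. F2 (x, t)))"
      using iF2 by (simp add: lborel_prod)
    have inner: "(\<integral>x. F2 (x, t) \<partial>lborel) = 0" for t :: real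
    proof -
      have "compact (fst ` K)" using K(1) by (intro compact_continuous_image continuous_intros)
      moreover have "fst ` K \<subseteq> ball 0 1" using K(2) by auto
      moreover have "C_k 2 (\<lambda>x. \<phi> (x, t))" using K(5) by (rule C_k_slice)
      moreover have "\<phi> (x, t) = 0" if "x \<notin> fst ` K" for x using \<phi>0[of "(x, t)"] that by force
      ultimately show ?thesis
        unfolding F2_def fst_conv snd_conv by (rule integral_V_equation)
    qed
    have "(\<integral>y. F2 y \<partial>lborel) = (\<integral>y. case_prod (\<lambda>x t. F2 (x, t)) y \<partial>(lborel \<Otimes>\<^sub>M lborel))"
      by (simp add: lborel_prod)
    also have "\<dots> = (\<integral>t. (\<integral>x. F2 (x, t) \<partial>lborel) \<partial>lborel)"
      by (rule lborel_pair.integral_snd[OF i, symmetric])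
    finally show ?thesis by (simp add: inner)
  qed
  have eq: "(case y of (x, t) \<Rightarrow> V x * (deriv (\<lambda>s. \<phi> (x, s)) t + laplacian (\<lambda>y. \<phi> (y, t)) x
      + u x \<bullet> grad (\<lambda>y. \<phi> (y, t)) x)) = F1 y + F2 y" for y
    by (cases y) (simp add: F1_def F2_def deriv distrib_left)
  have "(LINT y:ball 0 1 \<times> {0<..<1}|lebesgue. F1 y + F2 y) = (\<integral>y. F1 y + F2 y \<partial>lborel)"
  proof (rule set_integral_lebesgue_support)
    show "integrable lborel (\<lambda>y. F1 y + F2 y)" using iF1 iF2 by simp
    fix y assume "y \<notin> ball (0::'a) 1 \<times> {0<..<1::real}"
    then have "y \<notin> K" using K(2) by blast
    then have 0: "partial b \<phi> y = 0" "partial b (partial b \<phi>) y = 0" if "b \<in> Basis" for b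
      using supp[OF K(4)[OF that]] supp2[OF that] by blast+
    show "F1 y + F2 y = 0"
      by (simp add: F1_def F2_eq 0 T Basis_pair_left)
  qed
  also have "\<dots> = 0" using iF1 iF2 1 2 by simp
  finally show ?thesis unfolding eq .
qed

lemma weak_solution_V:
  assumes q: "2 * (j + (1 + j) / DIM('a)) < 1"
  shows "weak_solution (ball 0 1) 1 u (\<lambda>(x, t). V x)"
proof -
  have S: "ball (0::'a) 1 \<times> {0..1::real} \<in> sets borel"
    unfolding borel_prod[symmetric] by simp
  have Vm: "(\<lambda>(x, t). V x) \<in> borel_measurable (borel :: ('a \<times> real) measure)"
    and gm: "(\<lambda>(x, t). grad_V x) \<in> borel_measurable (borel :: ('a \<times> real) measure)"
    unfolding borel_prod[symmetric] by measurable
  have m: "set_borel_measurable lebesgue (ball (0::'a) 1 \<times> {0..1::real}) (\<lambda>(x, t). V x)"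
    "set_borel_measurable lebesgue (ball (0::'a) 1 \<times> {0..1::real}) (\<lambda>(x, t). grad_V x)"
    using Vm gm S by (auto intro: set_borel_measurable_lebesgue)
  have L: "in_Lp 2 (ball 0 1) V" "in_Lp 2 (ball 0 1) grad_V"
    using in_Lp_fields[of 2] q by auto
  have 1: "Linf_t_L2_x (ball 0 1) 1 (\<lambda>(x, t). V x)"
    unfolding Linf_t_L2_x_def using m(1) L by auto
  have 2: "L2_t_H1_x (ball 0 1) 1 (\<lambda>(x, t). V x)"
    unfolding L2_t_H1_x_def
    by (intro conjI m exI[of _ "\<lambda>(x, t). grad_V x"]) (simp_all add: L weak_gradient_V set_integrable_def)
  have 3: "locally_integrable (ball 0 1 \<times> {0<..<1::real}) (\<lambda>(x, t). V x)"
    by (intro locally_integrableI set_integrable_fst_cylinder fields_integrable)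
  have "locally_integrable (ball 0 1 \<times> {0<..<1::real}) (\<lambda>(x, t). V x *\<^sub>R u x)"
    by (intro locally_integrableI set_integrable_fst_cylinder integrable_V_u)
  then have 4: "locally_integrable (ball 0 1 \<times> {0<..<1::real}) (\<lambda>(x, t). (case (x, t) of (x, t) \<Rightarrow> V x) *\<^sub>R u x)"
    by simp
  show ?thesis
    unfolding weak_solution_def using 1 2 3 4 weak_equation by simp
qed

section \<open>Discontinuity at the origin\<close>

lemma V_cone_lower:
  assumes x: "x \<in> ball 0 1" "0 < x \<bullet> e" "x \<bullet> x \<le> 2 * (x \<bullet> e)\<^sup>2"
  shows "(2 + A) powr (- (1 / i)) \<le> V x"
proof -
  have ne: "x \<bullet> e \<noteq> 0" "x \<noteq> 0" using x by auto
  have p: "1 \<le> pw x" by (rule pw_ge_1[OF x(1) ne(1)])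
  have A0: "0 < A" using parameters_pos by simp
  have zi: "(x \<bullet> e) powr i = (x \<bullet> e)\<^sup>2 * pw x"
  proof -
    have "(x \<bullet> e) powr i = (x \<bullet> e) powr (2 + - j)" by (simp add: i_def)
    also have "\<dots> = (x \<bullet> e) powr 2 * pw x" unfolding pw_def using x(2) by (subst powr_add) simp
    finally show ?thesis using x(2) by (simp add: powr_numeral)
  qed
  \<comment> \<open>On the cone R <= 2 z^2 <= 2 z^i, since rho >= 1. So B is at most (2 + A) z^i,
    and z B^(-1/i) is bounded below independently of z.\<close>
  have "2 * (x \<bullet> e)\<^sup>2 \<le> 2 * ((x \<bullet> e)\<^sup>2 * pw x)"
    using p mult_left_mono[of 1 "pw x" "(x \<bullet> e)\<^sup>2"] by simp
  moreover have "A * (x \<bullet> e)\<^sup>2 * (pw x - 1) \<le> A * (x \<bullet> e)\<^sup>2 * pw x"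
    using A0 by (intro mult_left_mono) auto
  ultimately have "B x \<le> (2 + A) * (x \<bullet> e) powr i"
    using x(3) unfolding B_def zi by (simp add: distrib_right mult.assoc)
  then have "((2 + A) * (x \<bullet> e) powr i) powr (- (1 / i)) \<le> B x powr (- (1 / i))"
    using B_pos[OF x(1) ne(2)] i by (intro powr_mono2') auto
  moreover have "((2 + A) * (x \<bullet> e) powr i) powr (- (1 / i)) = (2 + A) powr (- (1 / i)) * (1 / (x \<bullet> e))"
  proof -
    have "((x \<bullet> e) powr i) powr (- (1 / i)) = (x \<bullet> e) powr (- 1)" using i by (simp add: powr_powr)
    then show ?thesis using A0 x(2) by (simp add: powr_mult powr_minus_divide)
  qed
  ultimately have "(x \<bullet> e) * ((2 + A) powr (- (1 / i)) * (1 / (x \<bullet> e))) \<le> V x"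
    unfolding V_def using x(2) by (intro mult_left_mono) auto
  then show ?thesis using x(2) by simp
qed

lemma V_odd: "V (- x) = - V x"
  by (simp add: V_def B_def pw_def)

lemma not_ae_continuous_V:
  "\<not> ae_continuous_at (ball 0 1 \<times> {0..1::real}) (0, 1) (\<lambda>(x, t). V x)"
proof
  let ?S = "ball (0::'a) 1 \<times> {0..1::real}"
  define d where "d = (2 + A) powr (- (1 / i))"
  have d: "0 < d" using parameters_pos by (simp add: d_def)
  assume "ae_continuous_at ?S (0, 1) (\<lambda>(x, t). V x)"
  then obtain w where w: "AE y in lebesgue. y \<in> ?S \<longrightarrow> w y = V (fst y)" "continuous (at (0, 1) within ?S) w"
    unfolding ae_continuous_at_def by (auto simp: split_beta')
  obtain r where r: "0 < r" "\<And>y. y \<in> ?S \<Longrightarrow> dist y (0, 1) < r \<Longrightarrow> dist (w y) (w (0, 1)) < d"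
    using w(2) d unfolding continuous_within_eps_delta by meson
  define m where "m = min 1 (r / 2)"
  have m: "0 < m" "m \<le> 1" "m \<le> r / 2" using r by (auto simp: m_def)
  \<comment> \<open>Truncated open cones around the two halves of the axis, at times just before 1.
    Strict inequalities make them open, a point on the axis makes them nonempty, so neither is a
    null set.\<close>
  define U where "U s = (ball (0::'a) m \<inter> {x. 0 < s * (x \<bullet> e)} \<inter> {x. x \<bullet> x < 2 * (x \<bullet> e)\<^sup>2}) \<times> {1 - m<..<1::real}" for s :: real
  have "open (U s)" for s
    unfolding U_def by (intro open_Times open_Int open_ball open_Collect_less continuous_intros open_greaterThanLessThan)
  moreover have "((s * m / 2) *\<^sub>R e, 1 - m / 2) \<in> U s" if "s = 1 \<or> s = -1" for s
    using that m by (auto simp: U_def power2_eq_square)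
  ultimately have ex: "\<exists>y. y \<in> U s \<and> (y \<in> ?S \<longrightarrow> w y = V (fst y))" if "s = 1 \<or> s = -1" for s
    using AE_lebesgue_open_witness[OF w(1), of "U s"] that by (metis empty_iff)
  have near: "y \<in> ?S" "dist y (0, 1) < r" if "y \<in> U s" for y s
  proof -
    show "y \<in> ?S" using that m by (auto simp: U_def)
    obtain x t where y: "y = (x, t)" by fastforce
    have "dist y (0, 1) = sqrt ((norm x)\<^sup>2 + \<bar>t - 1\<bar>\<^sup>2)"
      by (simp add: y dist_norm norm_Pair)
    also have "\<dots> \<le> norm x + \<bar>t - 1\<bar>" by (rule sqrt_sum_squares_le_sum) auto
    also have "\<dots> < r" using that m by (auto simp: U_def y)
    finally show "dist y (0, 1) < r" .
  qed
  obtain y where y: "y \<in> U 1" "y \<in> ?S \<longrightarrow> w y = V (fst y)" using ex[OF disjI1[OF refl]] by blast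
  obtain y' where y': "y' \<in> U (-1)" "y' \<in> ?S \<longrightarrow> w y' = V (fst y')" using ex[OF disjI2[OF refl]] by blast
  have "d \<le> V (fst y)"
    unfolding d_def using y(1) near(1)[OF y(1)] by (intro V_cone_lower) (auto simp: U_def)
  then have 1: "d \<le> w y" using y near by simp
  \<comment> \<open>Reflection maps the lower cone to the upper one and V is odd. So
    \<open>w\<close> has values at least 2 \<open>d\<close> apart at two points where it lies within
    \<open>d\<close> of its value at (0,1).\<close>
  have "d \<le> V (- fst y')"
    unfolding d_def using y'(1) near(1)[OF y'(1)] by (intro V_cone_lower) (auto simp: U_def)
  then have 2: "w y' \<le> - d" using y' near by (simp add: V_odd)
  have "dist (w y) (w (0, 1)) < d" "dist (w y') (w (0, 1)) < d"
    using r(2)[OF near[OF y(1)]] r(2)[OF near[OF y'(1)]] by simp_all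
  with 1 2 show False by (simp add: dist_real_def)
qed

end

section \<open>Choice of the parameters\<close>

theorem theorem1p2:
  fixes l :: real
  assumes "CARD('n::finite) \<ge> 3"
    and "0 < l" and "l < real CARD('n) - 1"
  shows "\<exists>T > 0. \<exists>u :: real ^ 'n \<Rightarrow> real ^ 'n.
           in_Lp (real CARD('n) - l) (ball 0 1) u \<and>
           divergence_free (ball 0 1) u \<and>
           (\<exists>v :: (real ^ 'n) \<times> real \<Rightarrow> real.
              weak_solution (ball 0 1) T u v \<and>
              essentially_bounded (ball 0 1 \<times> {0..T}) v \<and>
              \<not> ae_continuous_at (ball 0 1 \<times> {0..T}) (0, T) v)"
proof -
  let ?n = "real CARD('n)"
  define p where "p = ?n - l"
  \<comment> \<open>One exponent for two demands: \<open>p\<close> for the drift and 2 for V and its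
    gradient. The lower bound 2 also yields the locale condition on \<open>j\<close>.\<close>
  define q where "q = max p 2"
  \<comment> \<open>Weight 1 lies in L^q when q j (n + 1) < n - q; this \<open>j\<close> makes the
    left side half of the right.\<close>
  define j where "j = (?n - q) / (2 * q * (?n + 1))"
  have n: "3 \<le> ?n" using assms(1) by simp
  have p: "1 < p" "p < ?n" using assms by (auto simp: p_def)
  have q: "2 \<le> q" "p \<le> q" "q < ?n" using p n by (auto simp: q_def)
  have j0: "0 < j" using q n by (simp add: j_def)
  have jq: "q * (j * (?n + 1)) = (?n - q) / 2"
    using q n by (simp add: j_def)
  have dimn: "DIM(real ^ 'n) = CARD('n)" by simp
  have "2 * (j * (?n + 1)) \<le> q * (j * (?n + 1))"
    using q j0 n by (intro mult_right_mono) auto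
  then have "4 * (j * (?n + 1)) \<le> ?n - q" unfolding jq by simp
  then have "j * (?n + 1) < ?n - 2" using q by linarith
  moreover obtain e :: "real ^ 'n" where e: "e \<in> Basis"
    using nonempty_Basis by blast
  ultimately interpret axial_inflow e j
    using assms(1) j0 by unfold_locales (simp_all only: dimn)
  have "q * (j + (1 + j) / ?n) = (q * (j * (?n + 1)) + q) / ?n"
    using n by (simp add: field_simps)
  also have "\<dots> < 1" using jq q n by (simp add: divide_less_eq)
  finally have qj: "q * (j + (1 + j) / ?n) < 1" .
  have le: "s * (j + (1 + j) / ?n) < 1" if "s \<le> q" for s
    using mult_right_mono[OF that, of "j + (1 + j) / ?n"] j0 qj by fastforce
  have "in_Lp p (ball 0 1) u"
    using p le[OF q(2)] by (intro in_Lp_fields) (simp_all only: dimn)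
  moreover have "weak_solution (ball 0 1) 1 u (\<lambda>(x, t). V x)"
    using le[OF q(1)] by (intro weak_solution_V) (simp only: dimn)
  moreover have "essentially_bounded (ball 0 1 \<times> {0..1}) (\<lambda>(x, t). V x)"
    unfolding essentially_bounded_def using V_bound by (intro exI[of _ 1] AE_I2) auto
  ultimately show ?thesis
    \<comment> \<open>The solution is stationary, so the final time is a free choice; 1 is the one
      fixed in the preceding lemmas.\<close>
    unfolding p_def using divergence_free_u not_ae_continuous_V by (intro exI[of _ 1] conjI exI[of _ u]) auto
qed

end
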